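(* Let $G$ be a finite nilpotent group which is not a $p$-group (for any prime $p$). Then $\Gamma_S(G)$ is a cograph if and only if $G$ is either a cyclic group $C_{p^aq^b}$, where $p,q$ are distinct primes and $a,b\ge 1$, or of the form $Q_{2^a}\times C_{q^b}$, where $q$ is an odd prime, $a\ge 3$ and $b\ge 1$.
   Context: For a group $G$ with identity $e$, the intersection subgroup graph $\Gamma_S(G)$ is the simple graph whose vertices are the non-trivial subgroups $H$ of $G$ such that $H\cap K=\{e\}$ for some non-trivial subgroup $K$ of $G$; two distinct vertices $H,K$ are adjacent if and only if $H\cap K=\{e\}$. A graph is a cograph if it has no induced subgraph isomorphic to the path $P_4$ on four vertices. $C_n$ is the cyclic group of order $n$ and $Q_{2^a}$ ($a\ge 3$) is the generalized quaternion group of order $2^a$. *)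

theory Defs
  imports "HOL-Algebra.Algebra" "Graph_Theory.Graph_Theory"
begin

section \<open>The intersection subgroup graph and cographs\<close>

text \<open>A simple graph is a loopfree symmetric digraph without parallel arcs
  (locale \<^locale>\<open>pair_graph\<close> in the finite case), so each edge is a pair of opposite arcs.\<close>

definition isg_verts :: "('a, 'b) monoid_scheme \<Rightarrow> 'a set set" where
  "isg_verts G = {H. subgroup H G \<and> H \<noteq> {\<one>\<^bsub>G\<^esub>} \<and>
     (\<exists>K. subgroup K G \<and> K \<noteq> {\<one>\<^bsub>G\<^esub>} \<and> H \<inter> K = {\<one>\<^bsub>G\<^esub>})}"

definition intersection_subgroup_graph ::
    "('a, 'b) monoid_scheme \<Rightarrow> 'a set pair_pre_digraph" where
  "intersection_subgroup_graph G =
     \<lparr> pverts = isg_verts G,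
       parcs = {(H, K). H \<in> isg_verts G \<and> K \<in> isg_verts G \<and> H \<noteq> K \<and> H \<inter> K = {\<one>\<^bsub>G\<^esub>}} \<rparr>"

definition path_graph :: "nat \<Rightarrow> nat pair_pre_digraph" where
  "path_graph n =
     \<lparr> pverts = {..<n}, parcs = {(i, j). i < n \<and> j < n \<and> (j = Suc i \<or> i = Suc j)} \<rparr>"

definition cograph :: "('a, 'b) pre_digraph \<Rightarrow> bool" where
  "cograph D \<longleftrightarrow> \<not> (\<exists>H. induced_subgraph H D \<and> digraph_iso H (with_proj (path_graph 4)))"

text \<open>\<^const>\<open>induced_subgraph\<close> carries a well-formedness requirement on the ambient graph;
  the next two lemmas show that it is met here.\<close>

lemma pair_graph_intersection_subgroup_graph:
  assumes "finite (carrier G)"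
  shows "pair_graph (intersection_subgroup_graph G)"
proof -
  have "isg_verts G \<subseteq> Pow (carrier G)"
    by (auto simp: isg_verts_def dest: subgroup.mem_carrier)
  then have fin: "finite (isg_verts G)"
    using assms by (meson finite_Pow_iff finite_subset)
  have "finite (parcs (intersection_subgroup_graph G))"
    by (rule finite_subset[of _ "isg_verts G \<times> isg_verts G"])
       (auto simp: intersection_subgroup_graph_def fin)
  moreover have "symmetric (with_proj (intersection_subgroup_graph G))"
    by (auto simp: symmetric_def sym_def intersection_subgroup_graph_def Int_commute)
  ultimately show ?thesis
    using fin by unfold_locales (simp_all add: intersection_subgroup_graph_def split_beta)
qed

lemma pair_graph_path_graph: "pair_graph (path_graph n)"
proof -
  have "finite (parcs (path_graph n))"
    by (rule finite_subset[of _ "{..<n} \<times> {..<n}"]) (auto simp: path_graph_def)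
  moreover have "symmetric (with_proj (path_graph n))"
    by (auto simp: symmetric_def sym_def path_graph_def)
  ultimately show ?thesis
    by unfold_locales (auto simp: path_graph_def)
qed


section \<open>Nilpotent groups and p-groups\<close>

text \<open>The lower central series, indexed from 0, with commutators
  \<open>[x, y] = x y x\<^sup>-\<^sup>1 y\<^sup>-\<^sup>1\<close> as in \<^const>\<open>derived\<close>.\<close>

primrec lower_central :: "('a, 'b) monoid_scheme \<Rightarrow> nat \<Rightarrow> 'a set" where
  "lower_central G 0 = carrier G"
| "lower_central G (Suc n) = generate G
     (\<Union>x \<in> lower_central G n. \<Union>y \<in> carrier G. {x \<otimes>\<^bsub>G\<^esub> y \<otimes>\<^bsub>G\<^esub> inv\<^bsub>G\<^esub> x \<otimes>\<^bsub>G\<^esub> inv\<^bsub>G\<^esub> y})"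

definition nilpotent_group :: "('a, 'b) monoid_scheme \<Rightarrow> bool" where
  "nilpotent_group G \<longleftrightarrow> group G \<and> (\<exists>n. lower_central G n = {\<one>\<^bsub>G\<^esub>})"

text \<open>The case \<open>n = 0\<close> is included: the trivial group is a p-group for every prime.\<close>

definition finite_p_group :: "nat \<Rightarrow> ('a, 'b) monoid_scheme \<Rightarrow> bool" where
  "finite_p_group p G \<longleftrightarrow> group G \<and> Factorial_Ring.prime p \<and> (\<exists>n. order G = p ^ n)"


section \<open>Generalized quaternion groups\<close>

text \<open>\<open>Q\<^bsub>2^a\<^esub> = \<langle>x, y | x^(2^(a-1)) = 1, y^2 = x^(2^(a-2)), y x y\<^sup>-\<^sup>1 = x\<^sup>-\<^sup>1\<rangle>\<close>, in normal form:
  the pair \<open>(i, s)\<close> stands for \<open>x^i\<close> if \<open>s\<close> is false and for \<open>x^i y\<close> if \<open>s\<close> is true.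
  Meaningful for \<open>a \<ge> 2\<close> (with \<open>a = 2\<close> giving the cyclic group of order 4).\<close>

definition generalized_quaternion :: "nat \<Rightarrow> (int \<times> bool) monoid" where
  "generalized_quaternion a =
     \<lparr> carrier = {0..<2 ^ (a - 1)} \<times> UNIV,
       monoid.mult = (\<lambda>(i, s) (j, t).
         ((i + (if s then - j else j) + (if s \<and> t then 2 ^ (a - 2) else 0)) mod 2 ^ (a - 1),
          s \<noteq> t)),
       one = (0, False) \<rparr>"

lemma group_generalized_quaternion:
  assumes "a \<ge> 2"
  shows "group (generalized_quaternion a)"
proof -
  define m :: int where "m = 2 ^ (a - 2)"
  obtain k where k: "a = Suc (Suc k)"
    using assms by (metis Suc_le_D Suc_le_mono numeral_2_eq_2)
  have m: "m > 0" "(2::int) ^ (a - 1) = 2 * m"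
    by (simp_all add: m_def k)
  have Q: "generalized_quaternion a = \<lparr> carrier = {0..<2 * m} \<times> UNIV,
       monoid.mult = (\<lambda>(i, s) (j, t).
         ((i + (if s then - j else j) + (if s \<and> t then m else 0)) mod (2 * m), s \<noteq> t)),
       one = (0, False) \<rparr>"
    by (simp only: generalized_quaternion_def m(2) m_def[symmetric])
  show ?thesis
    unfolding Q
  proof (rule groupI, goal_cases)
    case (1 x y)
    obtain i s j t where xy: "x = (i, s)" "y = (j, t)"
      by (metis surj_pair)
    have "v mod (2 * m) \<in> {0..<2 * m}" for v
      using m(1) by simp
    then show ?case
      unfolding xy monoid.select_convs partial_object.select_convs case_prod_conv
      by (intro SigmaI UNIV_I)
  next
    case 2
    show ?case
      using m(1) by simp
  next
    case (3 x y z)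
    obtain i s j t k u where xyz: "x = (i, s)" "y = (j, t)" "z = (k, u)"
      by (metis surj_pair)
    define c where "c = (\<lambda>s t. if s \<and> t then m else 0)"
    define e where "e = (\<lambda>s (v::int). if s then - v else v)"
    have e_mod: "(v + e s (w mod (2 * m)) + r) mod (2 * m) = (v + e s w + r) mod (2 * m)" for v s w r
    proof -
      have "(v + e s (w mod (2 * m)) + r) - (v + e s w + r) = 2 * m * e s (- (w div (2 * m)))"
        by (simp add: e_def minus_mult_div_eq_mod[symmetric] algebra_simps)
      then show ?thesis
        by (metis dvd_triv_left mod_eq_dvd_iff)
    qed
    have "2 * m dvd (i + e s j + c s t + e (s \<noteq> t) k + c (s \<noteq> t) u)
        - (i + e s (j + e t k + c t u) + c s (t \<noteq> u))"
      by (cases s; cases t; cases u) (simp_all add: c_def e_def algebra_simps)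
    then have "(i + e s j + c s t + e (s \<noteq> t) k + c (s \<noteq> t) u) mod (2 * m)
        = (i + e s (j + e t k + c t u) + c s (t \<noteq> u)) mod (2 * m)"
      by (simp only: mod_eq_dvd_iff)
    then have "((i + e s j + c s t) mod (2 * m) + e (s \<noteq> t) k + c (s \<noteq> t) u) mod (2 * m)
        = (i + e s ((j + e t k + c t u) mod (2 * m)) + c s (t \<noteq> u)) mod (2 * m)"
      by (simp only: e_mod) (simp only: add.assoc mod_add_left_eq)
    moreover have "((s \<noteq> t) \<noteq> u) = (s \<noteq> (t \<noteq> u))"
      by auto
    ultimately show ?case
      unfolding xyz c_def e_def monoid.select_convs case_prod_conv prod.inject by (rule conjI)
  next
    case (5 x)
    obtain i s where x: "x = (i, s)"
      by (metis surj_pair)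
    define y where "y = (if s then ((m + i) mod (2 * m), True) else (- i mod (2 * m), False))"
    have "((m + i) mod (2 * m) - i + m) mod (2 * m) = 0"
      using mod_add_left_eq[of "m + i" "2 * m" "m - i"] by (simp add: algebra_simps)
    moreover have "(- i mod (2 * m) + i) mod (2 * m) = 0"
      using mod_add_left_eq[of "- i" "2 * m" i] by simp
    ultimately show ?case
      using m(1) by (intro bexI[of _ y]) (auto simp: x y_def)
  next
    case (4 x)
    obtain i s where x: "x = (i, s)"
      by (metis surj_pair)
    with 4 have "i mod (2 * m) = i"
      by (intro mod_pos_pos_trivial) simp_all
    then show ?case
      by (simp add: x)
  qed
qed


text \<open>The presentation is satisfied by \<open>x = (1, False)\<close> and \<open>y = (0, True)\<close>, the group has the
  right order, and every element is some \<open>x^i\<close> or \<open>x^i y\<close>.\<close>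

lemma order_generalized_quaternion:
  assumes "a \<ge> 1"
  shows "order (generalized_quaternion a) = 2 ^ a"
proof -
  obtain k where "a = Suc k"
    using assms by (cases a) auto
  then show ?thesis
    by (simp add: order_def generalized_quaternion_def card_cartesian_product nat_power_eq)
qed

lemma generalized_quaternion_pow_x:
  assumes "a \<ge> 2"
  shows "(1, False) [^]\<^bsub>generalized_quaternion a\<^esub> (n::nat) = (int n mod 2 ^ (a - 1), False)"
proof (induction n)
  case 0
  show ?case
    by (simp add: nat_pow_def generalized_quaternion_def)
next
  case (Suc n)
  have "(int n mod 2 ^ (a - 1) + 1) mod 2 ^ (a - 1) = int (Suc n) mod 2 ^ (a - 1)"
    by (simp only: mod_add_left_eq of_nat_Suc add.commute[of 1])
  then have "(int n mod 2 ^ (a - 1), False) \<otimes>\<^bsub>generalized_quaternion a\<^esub> (1, False)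
      = (int (Suc n) mod 2 ^ (a - 1), False)"
    by (simp add: generalized_quaternion_def)
  with Suc show ?case
    by (simp add: nat_pow_def)
qed

lemma generalized_quaternion_relations:
  assumes "a \<ge> 2"
  defines "Q \<equiv> generalized_quaternion a"
  defines "x \<equiv> (1 :: int, False)" and "y \<equiv> (0 :: int, True)"
  shows "x \<in> carrier Q" and "y \<in> carrier Q"
    and "x [^]\<^bsub>Q\<^esub> (2 ^ (a - 1) :: nat) = \<one>\<^bsub>Q\<^esub>"
    and "y [^]\<^bsub>Q\<^esub> (2 :: nat) = x [^]\<^bsub>Q\<^esub> (2 ^ (a - 2) :: nat)"
    and "y \<otimes>\<^bsub>Q\<^esub> x \<otimes>\<^bsub>Q\<^esub> inv\<^bsub>Q\<^esub> y = inv\<^bsub>Q\<^esub> x"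
    and "carrier Q = (\<Union>i::nat. {x [^]\<^bsub>Q\<^esub> i, x [^]\<^bsub>Q\<^esub> i \<otimes>\<^bsub>Q\<^esub> y})"
proof -
  obtain k where k: "a = Suc (Suc k)"
    using assms(1) by (metis Suc_le_D Suc_le_mono numeral_2_eq_2)
  interpret Q: group Q
    unfolding Q_def by (rule group_generalized_quaternion[OF assms(1)])
  note powx = generalized_quaternion_pow_x[OF assms(1), folded Q_def x_def]
  have "(1::int) \<le> 2 ^ k"
    by (rule one_le_power) simp
  then have lt: "(1::int) < 2 * 2 ^ k" "(2::int) ^ k < 2 * 2 ^ k"
    by linarith+
  have carrier_Q: "carrier Q = {0..<2 * 2 ^ k} \<times> UNIV"
    by (simp add: Q_def generalized_quaternion_def k)
  show x: "x \<in> carrier Q"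
    unfolding carrier_Q x_def
    by (rule SigmaI, unfold atLeastLessThan_iff, rule conjI, simp, rule lt(1), simp)
  show y: "y \<in> carrier Q"
    by (simp add: Q_def y_def generalized_quaternion_def)
  show "x [^]\<^bsub>Q\<^esub> (2 ^ (a - 1) :: nat) = \<one>\<^bsub>Q\<^esub>"
    by (simp add: powx) (simp add: Q_def generalized_quaternion_def)
  show "y [^]\<^bsub>Q\<^esub> (2 :: nat) = x [^]\<^bsub>Q\<^esub> (2 ^ (a - 2) :: nat)"
    by (simp add: powx numeral_2_eq_2 y)
       (simp add: Q_def y_def generalized_quaternion_def k)
  have "y \<otimes>\<^bsub>Q\<^esub> x = inv\<^bsub>Q\<^esub> x \<otimes>\<^bsub>Q\<^esub> y"
  proof -
    have "x \<otimes>\<^bsub>Q\<^esub> (y \<otimes>\<^bsub>Q\<^esub> x) = y"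
      by (simp add: Q_def x_def y_def generalized_quaternion_def mod_simps)
    then show ?thesis
      using x y by (metis Q.inv_solve_left Q.m_closed)
  qed
  then show "y \<otimes>\<^bsub>Q\<^esub> x \<otimes>\<^bsub>Q\<^esub> inv\<^bsub>Q\<^esub> y = inv\<^bsub>Q\<^esub> x"
    using x y by (simp add: Q.m_assoc)
  have "(i, s) \<in> (\<Union>i::nat. {x [^]\<^bsub>Q\<^esub> i, x [^]\<^bsub>Q\<^esub> i \<otimes>\<^bsub>Q\<^esub> y})" if "(i, s) \<in> carrier Q" for i s
  proof -
    have "0 \<le> i" "i < 2 ^ (a - 1)"
      using that by (auto simp: Q_def generalized_quaternion_def)
    then have p: "x [^]\<^bsub>Q\<^esub> nat i = (i, False)"
      by (simp add: powx)
    have q: "(i, False) \<otimes>\<^bsub>Q\<^esub> y = (i, True)"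
      using \<open>0 \<le> i\<close> \<open>i < 2 ^ (a - 1)\<close> by (simp add: Q_def y_def generalized_quaternion_def)
    have "(i, s) \<in> {x [^]\<^bsub>Q\<^esub> nat i, x [^]\<^bsub>Q\<^esub> nat i \<otimes>\<^bsub>Q\<^esub> y}"
      unfolding p q by (cases s) simp_all
    then show ?thesis
      by blast
  qed
  then show "carrier Q = (\<Union>i::nat. {x [^]\<^bsub>Q\<^esub> i, x [^]\<^bsub>Q\<^esub> i \<otimes>\<^bsub>Q\<^esub> y})"
    using x y by auto
qed

end

theory Submission
  imports Defs "HOL-Number_Theory.Residues"
begin

text \<open>
  A nilpotent group that is not a p-group has commuting elements of coprime prime orders. If \<open>x\<close>, \<open>y\<close>
  have prime order, \<open>\<langle>x\<rangle> \<noteq> \<langle>y\<rangle>\<close>, and \<open>z\<close> has a prime order different from both of theirs, then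
  \<open>\<langle>yz\<rangle> - \<langle>x\<rangle> - \<langle>y\<rangle> - \<langle>xz\<rangle>\<close> is an induced path. So in the cograph case \<open>G\<close> has exactly two subgroups
  of prime order; conversely, two such subgroups make the graph complete bipartite. It remains to classify
  p-groups \<open>P\<close> with a unique subgroup of order \<open>p\<close>. A maximal normal cyclic subgroup \<open>\<langle>x\<rangle>\<close> of \<open>P\<close> is its own
  centralizer. If \<open>y \<notin> \<langle>x\<rangle>\<close>, \<open>y^p = x^s\<close> and \<open>y x y\<^sup>-\<^sup>1 = x^r\<close>, then \<open>(x^k y)^p = x^(k (1 + r + \<dots> + r^(p-1)) + s)\<close>
  cannot be trivial for any \<open>k\<close>, which forces \<open>p = 2\<close>, \<open>y x y\<^sup>-\<^sup>1 = x\<^sup>-\<^sup>1\<close>, and \<open>y^2\<close> to be the involution of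
  \<open>\<langle>x\<rangle>\<close>. As \<open>-1\<close> is not a square modulo 4, \<open>\<langle>x\<rangle>\<close> then has index 2.
\<close>

section \<open>Cographs and the intersection subgroup graph\<close>

text \<open>The six conditions also separate the four subgroups: any two of them are told apart by a
  third one, which meets one trivially and the other not. So such a quadruple amounts to an induced
  \<open>path_graph 4\<close>, and the later arguments can forget digraph isomorphisms.\<close>

lemma not_cograph_iff_P4:
  fixes G :: "('a, 'b) monoid_scheme"
  shows "\<not> cograph (with_proj (intersection_subgroup_graph G)) \<longleftrightarrow>
    (\<exists>A \<in> isg_verts G. \<exists>B \<in> isg_verts G. \<exists>C \<in> isg_verts G. \<exists>D \<in> isg_verts G.
       A \<inter> B = {\<one>\<^bsub>G\<^esub>} \<and> B \<inter> C = {\<one>\<^bsub>G\<^esub>} \<and> C \<inter> D = {\<one>\<^bsub>G\<^esub>} \<and>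
       A \<inter> C \<noteq> {\<one>\<^bsub>G\<^esub>} \<and> B \<inter> D \<noteq> {\<one>\<^bsub>G\<^esub>} \<and> A \<inter> D \<noteq> {\<one>\<^bsub>G\<^esub>})"
    (is "_ \<longleftrightarrow> ?P4")
proof
  let ?\<Gamma> = "intersection_subgroup_graph G"
  assume "\<not> cograph (with_proj ?\<Gamma>)"
  then obtain H f where H: "induced_subgraph H (with_proj ?\<Gamma>)"
    and f: "pre_digraph.digraph_isomorphism H f" "with_proj (path_graph 4) = app_iso f H"
    by (auto simp: cograph_def digraph_iso_def)
  have tail_head: "tail H = fst" "head H = snd" and verts: "verts H \<subseteq> isg_verts G"
    and arcs: "arcs H = {e \<in> parcs ?\<Gamma>. fst e \<in> verts H \<and> snd e \<in> verts H}"
    using H by (auto simp: induced_subgraph_def subgraph_def compatible_def with_proj_def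
        intersection_subgroup_graph_def)
  have f_tail_head: "iso_tail f = fst" "iso_head f = snd"
    and f_verts: "iso_verts f ` verts H = {..<4}"
    and f_arcs: "iso_arcs f ` arcs H = parcs (path_graph 4)"
    using f(2) by (auto simp: app_iso_def with_proj_def path_graph_def)
  have inj: "inj_on (iso_verts f) (verts H)"
    and ends: "\<And>e. e \<in> arcs H \<Longrightarrow> iso_arcs f e = (iso_verts f (fst e), iso_verts f (snd e))"
    using f(1) by (auto simp: pre_digraph.digraph_isomorphism_def tail_head f_tail_head prod_eq_iff)
  \<comment> \<open>An isomorphism has separate maps on vertices and on arcs. Arcs carry over
    because \<open>iso_arcs f\<close> respects end points; they carry back because
    \<open>iso_verts f\<close> is injective.\<close>
  have adj: "(U, V) \<in> parcs ?\<Gamma> \<longleftrightarrow> (iso_verts f U, iso_verts f V) \<in> parcs (path_graph 4)"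
    if UV: "U \<in> verts H" "V \<in> verts H" for U V
  proof
    assume "(U, V) \<in> parcs ?\<Gamma>"
    then have "(U, V) \<in> arcs H"
      using UV by (simp add: arcs)
    then show "(iso_verts f U, iso_verts f V) \<in> parcs (path_graph 4)"
      using ends f_arcs by force
  next
    assume "(iso_verts f U, iso_verts f V) \<in> parcs (path_graph 4)"
    then obtain e where e: "e \<in> arcs H" "iso_arcs f e = (iso_verts f U, iso_verts f V)"
      using f_arcs by force
    then have "fst e = U" "snd e = V"
      using ends[OF e(1)] UV inj arcs by (auto dest: inj_onD)
    then show "(U, V) \<in> parcs ?\<Gamma>"
      using e(1) unfolding arcs by (cases e) simp
  qed
  have "\<exists>U \<in> verts H. iso_verts f U = i" if "i < 4" for i
    using f_verts that by (metis imageE lessThan_iff)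
  then obtain A B C D where V: "A \<in> verts H" "B \<in> verts H" "C \<in> verts H" "D \<in> verts H"
    and i: "iso_verts f A = 0" "iso_verts f B = 1" "iso_verts f C = 2" "iso_verts f D = 3"
    by (metis one_less_numeral_iff numeral_less_iff semiring_norm(76,78,79,81) zero_less_numeral)
  have "A \<noteq> C" "B \<noteq> D" "A \<noteq> D"
    using i by auto
  moreover have "(A, B) \<in> parcs ?\<Gamma>" "(B, C) \<in> parcs ?\<Gamma>" "(C, D) \<in> parcs ?\<Gamma>"
    "(A, C) \<notin> parcs ?\<Gamma>" "(B, D) \<notin> parcs ?\<Gamma>" "(A, D) \<notin> parcs ?\<Gamma>"
    using V i by (simp_all add: adj) (simp_all add: path_graph_def)
  moreover have in_V: "A \<in> isg_verts G" "B \<in> isg_verts G" "C \<in> isg_verts G" "D \<in> isg_verts G"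
    using V verts by auto
  ultimately have "A \<inter> B = {\<one>\<^bsub>G\<^esub>}" "B \<inter> C = {\<one>\<^bsub>G\<^esub>}" "C \<inter> D = {\<one>\<^bsub>G\<^esub>}"
      "A \<inter> C \<noteq> {\<one>\<^bsub>G\<^esub>}" "B \<inter> D \<noteq> {\<one>\<^bsub>G\<^esub>}" "A \<inter> D \<noteq> {\<one>\<^bsub>G\<^esub>}"
    by (simp_all add: intersection_subgroup_graph_def)
  with in_V show ?P4
    by blast
next
  let ?\<Gamma> = "intersection_subgroup_graph G"
  assume ?P4
  then obtain A B C D where V: "A \<in> isg_verts G" "B \<in> isg_verts G" "C \<in> isg_verts G"
      "D \<in> isg_verts G"
    and I: "A \<inter> B = {\<one>\<^bsub>G\<^esub>}" "B \<inter> C = {\<one>\<^bsub>G\<^esub>}" "C \<inter> D = {\<one>\<^bsub>G\<^esub>}"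
      "A \<inter> C \<noteq> {\<one>\<^bsub>G\<^esub>}" "B \<inter> D \<noteq> {\<one>\<^bsub>G\<^esub>}" "A \<inter> D \<noteq> {\<one>\<^bsub>G\<^esub>}"
    by (elim bexE conjE) (rule that)
  have dist: "A \<noteq> B" "A \<noteq> C" "A \<noteq> D" "B \<noteq> C" "B \<noteq> D" "C \<noteq> D"
    using I by (auto simp: Int_commute)
  define S where "S = {A, B, C, D}"
  have S: "S \<subseteq> isg_verts G"
    using V by (simp add: S_def)
  define H where "H = with_proj \<lparr> pverts = S, parcs = {(U, V). (U, V) \<in> parcs ?\<Gamma> \<and> U \<in> S \<and> V \<in> S} \<rparr>"
  \<comment> \<open>The labels follow the order of the path; the final default 3 is the label of
    \<open>D\<close>.\<close>
  define g where "g U = (if U = A then 0 else if U = B then 1 else if U = C then 2 else 3 :: nat)" for U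
  define f where "f = \<lparr> iso_verts = g, iso_arcs = map_prod g g, iso_head = snd, iso_tail = fst \<rparr>"
  have arcsH: "arcs H = {(A, B), (B, A), (B, C), (C, B), (C, D), (D, C)}"
  proof -
    define R where "R U V \<longleftrightarrow> U \<noteq> V \<and> U \<inter> V = {\<one>\<^bsub>G\<^esub>}" for U V
    have R: "R A B" "R B A" "R B C" "R C B" "R C D" "R D C" "\<not> R A C" "\<not> R C A" "\<not> R B D" "\<not> R D B"
        "\<not> R A D" "\<not> R D A" "\<not> R A A" "\<not> R B B" "\<not> R C C" "\<not> R D D"
      using I dist by (simp_all add: R_def Int_commute)
    have "(U, V) \<in> parcs ?\<Gamma> \<longleftrightarrow> R U V" if "U \<in> isg_verts G" "V \<in> isg_verts G" for U V
      using that by (simp add: intersection_subgroup_graph_def R_def)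
    then have "arcs H = {(U, V). U \<in> S \<and> V \<in> S \<and> R U V}"
      using S by (auto simp: H_def with_proj_def)
    then show ?thesis
      unfolding S_def using R by auto
  qed
  have wf_\<Gamma>: "wf_digraph (with_proj ?\<Gamma>)"
    by unfold_locales (simp_all add: with_proj_def intersection_subgroup_graph_def split_beta)
  have wf_H: "wf_digraph H"
    by unfold_locales (auto simp: H_def with_proj_def)
  have "induced_subgraph H (with_proj ?\<Gamma>)"
  proof -
    have "pverts ?\<Gamma> = isg_verts G"
      by (simp add: intersection_subgroup_graph_def)
    then show ?thesis
      using S wf_\<Gamma> wf_H
      by (auto simp: induced_subgraph_def subgraph_def compatible_def H_def with_proj_def)
  qed
  moreover have "inj_on g S"
    using dist by (auto simp: inj_on_def S_def g_def)
  then have "inj_on (map_prod g g) (arcs H)"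
    by (intro inj_on_subset[OF map_prod_inj_on]) (auto simp: H_def with_proj_def)
  then have "pre_digraph.digraph_isomorphism H f"
    using wf_H \<open>inj_on g S\<close>
    by (auto simp: pre_digraph.digraph_isomorphism_def f_def) (auto simp: H_def with_proj_def)
  moreover have "with_proj (path_graph 4) = app_iso f H"
  proof -
    have g: "g A = 0" "g B = 1" "g C = 2" "g D = 3"
      using dist by (simp_all add: g_def)
    have four: "{..<4} = {0, 1, 2, 3 :: nat}"
      by auto
    have "g ` S = {..<4}"
      by (simp add: S_def g four)
    moreover have "parcs (path_graph 4) = {(0, 1), (1, 0), (1, 2), (2, 1), (2, 3), (3, 2)}"
      by (auto simp: path_graph_def numeral_eq_Suc less_Suc_eq)
    then have "map_prod g g ` arcs H = parcs (path_graph 4)"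
      by (simp add: arcsH g)
    ultimately show ?thesis
      by (simp add: app_iso_def f_def with_proj_def path_graph_def H_def)
  qed
  ultimately show "\<not> cograph (with_proj ?\<Gamma>)"
    by (auto simp: cograph_def digraph_iso_def)
qed

section \<open>Pairs of elements that meet every non-trivial subgroup\<close>

text \<open>Only powers of single elements occur, so the condition is easy to verify and to
  transport along isomorphisms; yet it puts \<open>u\<close> or \<open>v\<close> into every
  non-trivial subgroup. In the applications \<open>u\<close> and \<open>v\<close> generate the
  subgroups of prime order.\<close>

definition power_pair :: "('a, 'b) monoid_scheme \<Rightarrow> 'a \<Rightarrow> 'a \<Rightarrow> bool" where
  "power_pair G u v \<longleftrightarrow> u \<in> carrier G \<and> v \<in> carrier G \<and> u \<noteq> \<one>\<^bsub>G\<^esub> \<and> v \<noteq> \<one>\<^bsub>G\<^esub> \<and>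
     (\<forall>g \<in> carrier G - {\<one>\<^bsub>G\<^esub>}. \<exists>k::nat. g [^]\<^bsub>G\<^esub> k = u \<or> g [^]\<^bsub>G\<^esub> k = v)"

lemma (in group) power_pair_subgroup:
  assumes "power_pair G u v" and "subgroup H G" and "H \<noteq> {\<one>}"
  shows "u \<in> H \<or> v \<in> H"
proof -
  obtain g where "g \<in> H" "g \<noteq> \<one>"
    using assms(2,3) subgroup.one_closed by blast
  moreover have "g [^] k \<in> H" for k :: nat
    using subgroup_int_pow_closed[OF assms(2) \<open>g \<in> H\<close>, of "int k"] by (simp add: int_pow_int)
  ultimately show ?thesis
    using assms(1) subgroup.mem_carrier[OF assms(2)] unfolding power_pair_def by (metis DiffI singletonD)
qed

text \<open>Each vertex contains \<open>u\<close> or \<open>v\<close>, and adjacent vertices cannot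
  share one. So the two elements alternate along a path, and \<open>A\<close> and \<open>D\<close>,
  three edges apart, cannot have one in common; but \<open>A \<inter> D\<close> is itself a
  non-trivial subgroup.\<close>

lemma (in group) cograph_if_power_pair:
  assumes "power_pair G u v"
  shows "cograph (with_proj (intersection_subgroup_graph G))"
proof (rule ccontr)
  assume "\<not> ?thesis"
  then obtain A B C D where V: "A \<in> isg_verts G" "B \<in> isg_verts G" "C \<in> isg_verts G"
      "D \<in> isg_verts G"
    and I: "A \<inter> B = {\<one>}" "B \<inter> C = {\<one>}" "C \<inter> D = {\<one>}" "A \<inter> D \<noteq> {\<one>}"
    unfolding not_cograph_iff_P4 by (elim bexE conjE) (rule that)
  have uv: "u \<noteq> \<one>" "v \<noteq> \<one>"
    using assms by (auto simp: power_pair_def)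
  have sub: "subgroup U G" "U \<noteq> {\<one>}" if "U \<in> isg_verts G" for U
    using that by (auto simp: isg_verts_def)
  have mem: "u \<in> U \<or> v \<in> U" if "subgroup U G" "U \<noteq> {\<one>}" for U
    using power_pair_subgroup[OF assms that] .
  have "u \<in> A \<inter> D \<or> v \<in> A \<inter> D"
    using mem[OF subgroups_Inter_pair] sub V I by blast
  moreover have "u \<in> U \<or> v \<in> U" if "U \<in> {A, B, C, D}" for U
    using that mem sub V by blast
  moreover have "x \<notin> U \<or> x \<notin> W" if "U \<inter> W = {\<one>}" "x \<noteq> \<one>" for U W x
    using that by blast
  ultimately show False
    using I(1-3) uv by (metis IntD1 IntD2 insertCI)
qed

lemma power_pair_iso:
  assumes "group G" "group H" "G \<cong> H" "power_pair H u v"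
  shows "\<exists>u v. power_pair G u v"
proof -
  obtain f where f: "f \<in> iso H G"
    using assms(1-3) group.iso_sym is_iso_def by blast
  interpret f: group_hom H G f
    using f assms(1,2) by (simp add: group_hom_def group_hom_axioms_def iso_def)
  have bij: "bij_betw f (carrier H) (carrier G)"
    using f by (simp add: iso_def)
  have ne: "f w \<noteq> \<one>\<^bsub>G\<^esub>" if "w \<in> carrier H" "w \<noteq> \<one>\<^bsub>H\<^esub>" for w
    using that bij f.hom_one unfolding bij_betw_def inj_on_def by (metis f.H.one_closed f.G.one_closed)
  have uv: "u \<in> carrier H" "v \<in> carrier H" "u \<noteq> \<one>\<^bsub>H\<^esub>" "v \<noteq> \<one>\<^bsub>H\<^esub>"
    using assms(4) by (auto simp: power_pair_def)
  have "\<exists>k::nat. g [^]\<^bsub>G\<^esub> k = f u \<or> g [^]\<^bsub>G\<^esub> k = f v" if g: "g \<in> carrier G - {\<one>\<^bsub>G\<^esub>}" for g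
  proof -
    obtain h where h: "h \<in> carrier H" "g = f h"
      using bij g by (auto simp: bij_betw_def)
    then have "h \<noteq> \<one>\<^bsub>H\<^esub>"
      using g by auto
    then obtain k :: nat where "h [^]\<^bsub>H\<^esub> k = u \<or> h [^]\<^bsub>H\<^esub> k = v"
      using assms(4) h unfolding power_pair_def by blast
    then have "g [^]\<^bsub>G\<^esub> k = f u \<or> g [^]\<^bsub>G\<^esub> k = f v"
      using h f.hom_nat_pow by metis
    then show ?thesis ..
  qed
  then have "power_pair G (f u) (f v)"
    unfolding power_pair_def using uv ne by auto
  then show ?thesis
    by blast
qed

section \<open>Powers of prime order in the groups of the classification\<close>

text \<open>The gcd \<open>d\<close> of \<open>g\<close> and \<open>n\<close> is a proper divisor of
  \<open>n\<close>. For a prime \<open>r\<close> dividing \<open>n div d\<close>, the number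
  \<open>n div r\<close> is a multiple of \<open>d\<close>, and by Bezout \<open>d\<close> is a
  multiple of \<open>g\<close> modulo \<open>n\<close>. In additive terms, some multiple of a
  non-zero residue has prime order.\<close>

lemma exists_multiple_eq_div_prime:
  fixes n :: nat and g :: int
  assumes "n > 0" and "\<not> int n dvd g"
  obtains r k :: nat where "Factorial_Ring.prime r" "r dvd n" "(int k * g) mod int n = int (n div r)"
proof -
  define d where "d = nat (gcd g (int n))"
  have d: "int d = gcd g (int n)"
    by (simp add: d_def)
  then have "d dvd n"
    by (metis gcd_dvd2 int_dvd_int_iff)
  moreover have "d \<noteq> n"
    using assms(2) d by (metis gcd_dvd1)
  ultimately have "n div d \<noteq> 1"
    using assms(1) by (metis dvd_mult_div_cancel mult.right_neutral)
  then obtain r where r: "Factorial_Ring.prime r" "r dvd n div d"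
    using prime_factor_nat by blast
  then obtain m where "n div d = r * m"
    by blast
  with \<open>d dvd n\<close> have n: "n = r * (d * m)"
    by (metis dvd_mult_div_cancel mult.assoc mult.left_commute)
  have "r > 1"
    using r(1) prime_gt_1_nat by blast
  then have div: "n div r = d * m" "n div r < n"
    using n assms(1) by auto
  obtain s t where st: "int d = s * g + t * int n"
    using bezout_int[of g "int n"] d by metis
  \<comment> \<open>As \<open>n div r = d * m\<close> and \<open>d = s * g + t * n\<close>, the
    multiplier is \<open>m * s\<close>; reduction modulo \<open>n\<close> makes it a natural
    number.\<close>
  define k where "k = nat ((int m * s) mod int n)"
  have "int k = (int m * s) mod int n"
    using assms(1) by (simp add: k_def)
  then have "(int k * g) mod int n = (int m * s * g) mod int n"
    by (simp add: mod_mult_left_eq)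
  also have "\<dots> = (int m * s * g + int m * t * int n) mod int n"
    by simp
  also have "int m * s * g + int m * t * int n = int (n div r)"
    by (simp add: div(1) st algebra_simps)
  also have "\<dots> mod int n = int (n div r)"
    using div(2) by simp
  finally show thesis
    using that r(1) n by (metis dvd_triv_left)
qed

text \<open>\<open>p\<close> and \<open>q\<close> are the only prime divisors of \<open>n\<close>,
  so the multiple of prime order that a non-zero residue possesses is \<open>n div p\<close> or
  \<open>n div q\<close>.\<close>

lemma power_pair_integer_mod_group:
  fixes p q a b :: nat
  assumes "Factorial_Ring.prime p" "Factorial_Ring.prime q" "a \<ge> 1" "b \<ge> 1"
  defines "n \<equiv> p ^ a * q ^ b"
  shows "power_pair (integer_mod_group n) (int (n div p)) (int (n div q))"
proof -
  have n: "n > 0" "p > 1" "q > 1"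
    using assms prime_gt_1_nat[of p] prime_gt_1_nat[of q] by auto
  have dvd: "p dvd n" "q dvd n"
    using assms by (auto simp: n_def intro: dvd_mult dvd_mult2)
  have car: "carrier (integer_mod_group n) = {0..<int n}"
    using n by (simp add: carrier_integer_mod_group)
  have "\<exists>k::nat. g [^]\<^bsub>integer_mod_group n\<^esub> k = int (n div p) \<or> g [^]\<^bsub>integer_mod_group n\<^esub> k = int (n div q)"
    if "g \<in> carrier (integer_mod_group n) - {0}" for g
  proof -
    have "\<not> int n dvd g"
      using that zdvd_imp_le[of "int n" g] by (auto simp: car)
    then obtain r k where r: "Factorial_Ring.prime r" "r dvd n" "(int k * g) mod int n = int (n div r)"
      using exists_multiple_eq_div_prime[OF n(1)] by metis
    then have "r = p \<or> r = q"
      using assms(1,2) unfolding n_def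
      by (metis prime_dvd_mult_iff prime_dvd_power primes_dvd_imp_eq)
    then show ?thesis
      using r(3) by auto
  qed
  moreover have "0 < n div p" "n div p < n" "0 < n div q" "n div q < n"
    using n dvd by (auto simp: div_greater_zero_iff dvd_imp_le)
  ultimately show ?thesis
    unfolding power_pair_def by (simp add: car)
qed

lemma DirProd_nat_pow:
  fixes k :: nat
  shows "(x, y) [^]\<^bsub>G \<times>\<times> H\<^esub> k = (x [^]\<^bsub>G\<^esub> k, y [^]\<^bsub>H\<^esub> k)"
  by (induction k) (simp_all add: nat_pow_def)

text \<open>An element \<open>x^i y\<close> squares to the involution \<open>x^(2^(a-2))\<close>;
  for a non-trivial \<open>x^i\<close> the claim lives in a cyclic group whose order has 2 as its
  only prime divisor.\<close>

lemma generalized_quaternion_power_eq_involution: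
  assumes "a \<ge> 2" and "h \<in> carrier (generalized_quaternion a)" and "h \<noteq> (0, False)"
  shows "\<exists>k::nat. h [^]\<^bsub>generalized_quaternion a\<^esub> k = (2 ^ (a - 2), False)"
proof -
  interpret Q: group "generalized_quaternion a"
    using assms(1) by (rule group_generalized_quaternion)
  obtain m where a: "a = Suc (Suc m)"
    using assms(1) by (metis Suc_le_D Suc_le_mono numeral_2_eq_2)
  obtain i s where h: "h = (i, s)"
    by (metis surj_pair)
  have i: "0 \<le> i" "i < 2 ^ (a - 1)"
    using assms(2) by (auto simp: h generalized_quaternion_def)
  show ?thesis
  proof (cases s)
    case True
    have "h [^]\<^bsub>generalized_quaternion a\<^esub> (2::nat) = (2 ^ (a - 2), False)"
      using Q.nat_pow_Suc[of h 1] assms(2) True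
      by (simp add: h numeral_2_eq_2) (simp add: generalized_quaternion_def a)
    then show ?thesis ..
  next
    case False
    define n :: nat where "n = 2 ^ (a - 1)"
    have n: "int n = 2 ^ (a - 1)" "n > 0"
      by (simp_all add: n_def)
    have "\<not> int n dvd i"
      using i assms(3) False zdvd_imp_le[of "int n" i] by (auto simp: h n)
    then obtain r k :: nat where r: "Factorial_Ring.prime r" "r dvd n" "(int k * i) mod int n = int (n div r)"
      using exists_multiple_eq_div_prime[OF n(2)] by metis
    then have "r = 2"
      unfolding n_def by (meson prime_dvd_power primes_dvd_imp_eq two_is_prime_nat)
    then have k: "(int k * i) mod 2 ^ (a - 1) = 2 ^ (a - 2)"
      using r(3) by (simp add: n n_def a)
    have "h = (1, False) [^]\<^bsub>generalized_quaternion a\<^esub> nat i"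
      using i False by (simp add: h generalized_quaternion_pow_x[OF assms(1)])
    then have "h [^]\<^bsub>generalized_quaternion a\<^esub> k = (1, False) [^]\<^bsub>generalized_quaternion a\<^esub> (nat i * k)"
      using generalized_quaternion_relations(1)[OF assms(1)] by (simp add: Q.nat_pow_pow)
    then have "h [^]\<^bsub>generalized_quaternion a\<^esub> k = (2 ^ (a - 2), False)"
      using i k by (simp add: generalized_quaternion_pow_x[OF assms(1)] mult.commute)
    then show ?thesis ..
  qed
qed

text \<open>If the cyclic component vanishes, a power of the quaternion component is the involution.
  Otherwise the exponent \<open>2 ^ a\<close> kills the quaternion component but not the cyclic one,
  as \<open>q\<close> is odd, and a further multiple of the latter is
  \<open>q ^ b div q\<close>.\<close>

lemma power_pair_quaternion_times_cyclic:
  fixes q a b :: nat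
  assumes "Factorial_Ring.prime q" "odd q" "a \<ge> 2" "b \<ge> 1"
  shows "power_pair (generalized_quaternion a \<times>\<times> integer_mod_group (q ^ b))
    ((2 ^ (a - 2), False), 0) ((0, False), int (q ^ b div q))"
proof -
  let ?Q = "generalized_quaternion a" and ?n = "q ^ b"
  interpret Q: group ?Q
    using assms(3) by (rule group_generalized_quaternion)
  have oneQ: "\<one>\<^bsub>?Q\<^esub> = (0, False)"
    by (simp add: generalized_quaternion_def)
  have z: "(2 ^ (a - 2), False) \<in> carrier ?Q"
    by (auto simp: generalized_quaternion_def intro!: power_strict_increasing) (use assms(3) in simp)
  have n: "?n > 0" "0 < ?n div q" "?n div q < ?n"
    using assms prime_gt_1_nat[of q] by (auto simp: div_greater_zero_iff self_le_power dvd_imp_le)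
  have car: "carrier (integer_mod_group ?n) = {0..<int ?n}"
    using n by (simp add: carrier_integer_mod_group)
  have pow: "\<exists>k::nat. (h, c) [^]\<^bsub>?Q \<times>\<times> integer_mod_group ?n\<^esub> k \<in> {((2 ^ (a - 2), False), 0), ((0, False), int (?n div q))}"
    if h: "h \<in> carrier ?Q" and c: "c \<in> {0..<int ?n}" and ne: "(h, c) \<noteq> ((0, False), 0)" for h c
  proof (cases "c = 0")
    case True
    then obtain k :: nat where "h [^]\<^bsub>?Q\<^esub> k = (2 ^ (a - 2), False)"
      using generalized_quaternion_power_eq_involution[OF assms(3) h] ne by auto
    then show ?thesis
      using True by (intro exI[of _ k]) (simp add: DirProd_nat_pow)
  next
    case False
    have "\<not> int ?n dvd c"
      using False c zdvd_imp_le[of "int ?n" c] by auto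
    moreover have "coprime (int ?n) (2 ^ a)"
      using assms(2) by simp
    ultimately have "\<not> int ?n dvd 2 ^ a * c"
      by (metis coprime_dvd_mult_right_iff)
    then obtain r k :: nat where r: "Factorial_Ring.prime r" "r dvd ?n" "(int k * (2 ^ a * c)) mod int ?n = int (?n div r)"
      using exists_multiple_eq_div_prime[OF n(1)] by metis
    then have "r = q"
      using assms(1) by (meson prime_dvd_power primes_dvd_imp_eq)
    have "h [^]\<^bsub>?Q\<^esub> ((2::nat) ^ a) = \<one>\<^bsub>?Q\<^esub>"
      using Q.pow_order_eq_1[OF h] order_generalized_quaternion[of a] assms(3) by simp
    then have "h [^]\<^bsub>?Q\<^esub> ((2::nat) ^ a * k) = (0, False)"
      using h by (simp add: Q.nat_pow_pow[symmetric] oneQ[symmetric])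
    then show ?thesis
      using r(3) \<open>r = q\<close> by (intro exI[of _ "2 ^ a * k"]) (simp add: DirProd_nat_pow ac_simps)
  qed
  have carG: "carrier (?Q \<times>\<times> integer_mod_group ?n) = carrier ?Q \<times> {0..<int ?n}"
    using car by (simp add: DirProd_def)
  have oneG: "\<one>\<^bsub>?Q \<times>\<times> integer_mod_group ?n\<^esub> = ((0, False), 0)"
    by (simp add: oneQ)
  have one_mem: "(0, False) \<in> carrier ?Q"
    using Q.one_closed by (simp only: oneQ)
  show ?thesis
    unfolding power_pair_def carG oneG
  proof (intro conjI ballI)
    fix g assume g: "g \<in> carrier ?Q \<times> {0..<int ?n} - {((0, False), 0)}"
    obtain h c where "g = (h, c)"
      by (metis surj_pair)
    with g pow[of h c] show "\<exists>k::nat. g [^]\<^bsub>?Q \<times>\<times> integer_mod_group ?n\<^esub> k = ((2 ^ (a - 2), False), 0) \<or>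
        g [^]\<^bsub>?Q \<times>\<times> integer_mod_group ?n\<^esub> k = ((0, False), int (?n div q))"
      by auto
  qed (use z n one_mem in auto)
qed

section \<open>Nilpotent groups\<close>

lemma (in group) inv_mult_cancel [simp]:
  assumes "x \<in> carrier G" "y \<in> carrier G"
  shows "inv x \<otimes> (x \<otimes> y) = y" "x \<otimes> (inv x \<otimes> y) = y"
  using assms by (simp_all flip: m_assoc)

text \<open>A commutator \<open>c\<close> that commutes with \<open>x\<close> and \<open>y\<close>
  comes out once per transposition: \<open>x^i y = c^i y x^i\<close> and
  \<open>x y^i = c^i y^i x\<close>. Thus both coprime exponents \<open>m\<close> and
  \<open>k\<close> kill \<open>c\<close>.\<close>

lemma (in group) commute_if_commutator_central_coprime:
  fixes m k :: nat
  assumes x: "x \<in> carrier G" and y: "y \<in> carrier G"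
    and c: "c = x \<otimes> y \<otimes> inv x \<otimes> inv y" "c \<otimes> x = x \<otimes> c" "c \<otimes> y = y \<otimes> c"
    and pow: "x [^] m = \<one>" "y [^] k = \<one>" and "coprime m k"
  shows "c = \<one>"
proof -
  have cG: "c \<in> carrier G"
    using x y by (simp add: c(1))
  have xy: "x \<otimes> y = c \<otimes> y \<otimes> x"
    using x y by (simp add: c(1) m_assoc)
  have xc: "x [^] i \<otimes> c = c \<otimes> x [^] i" for i :: nat
    using x cG c(2) by (metis group_commutes_pow)
  have yc: "y [^] i \<otimes> c = c \<otimes> y [^] i" for i :: nat
    using y cG c(3) by (metis group_commutes_pow)
  have "x [^] i \<otimes> y = c [^] i \<otimes> y \<otimes> x [^] i" for i :: nat
  proof (induction i)
    case (Suc i)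
    have "x [^] Suc i \<otimes> y = x [^] i \<otimes> (x \<otimes> y)"
      using x y by (simp add: m_assoc)
    also have "\<dots> = c \<otimes> (x [^] i \<otimes> y) \<otimes> x"
      unfolding xy using x y cG xc by (metis m_assoc m_closed nat_pow_closed)
    also have "\<dots> = c [^] Suc i \<otimes> y \<otimes> x [^] Suc i"
      unfolding Suc using x y cG by (metis m_assoc m_closed nat_pow_closed nat_pow_Suc nat_pow_Suc2)
    finally show ?case .
  qed (use x y in simp)
  from this[of m] have "c [^] m = \<one>"
    using y cG pow(1) by simp
  moreover have "x \<otimes> y [^] i = c [^] i \<otimes> y [^] i \<otimes> x" for i :: nat
  proof (induction i)
    case (Suc i)
    have "x \<otimes> y [^] Suc i = (x \<otimes> y [^] i) \<otimes> y"
      using x y by (simp add: m_assoc)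
    also have "\<dots> = c [^] i \<otimes> (y [^] i \<otimes> c) \<otimes> y \<otimes> x"
      unfolding Suc using x y cG xy by (simp add: m_assoc)
    also have "\<dots> = c [^] Suc i \<otimes> y [^] Suc i \<otimes> x"
      unfolding yc using x y cG by (simp add: m_assoc)
    finally show ?case .
  qed (use x y in simp)
  from this[of k] have "c [^] k = \<one>"
    using x cG pow(2) by simp
  ultimately have "ord c dvd 1"
    using cG \<open>coprime m k\<close> pow_eq_id by (metis coprime_common_divisor_nat coprime_def dvd_1_iff_1)
  then show ?thesis
    using cG pow_eq_id[of c 1] by simp
qed

text \<open>Conjugation is an automorphism: it turns the commutator of \<open>x\<close> and
  \<open>y\<close> into that of their conjugates, and by induction the conjugate of \<open>x\<close>
  stays in the previous term.\<close>

lemma (in group) lower_central_normal: "lower_central G n \<lhd> G"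
proof (induction n)
  case 0
  show ?case
    by (simp add: normal_self)
next
  case (Suc n)
  interpret N: normal "lower_central G n" G
    by (rule Suc)
  show ?case
    unfolding lower_central.simps
  proof (rule normal_generateI, goal_cases)
    case 1
    then show ?case
      by auto
  next
    case (2 h g)
    then obtain x y where xy: "x \<in> lower_central G n" "y \<in> carrier G" "h = x \<otimes> y \<otimes> inv x \<otimes> inv y"
      by blast
    have x: "x \<in> carrier G"
      using xy by auto
    have conj: "g \<otimes> (u \<otimes> v) \<otimes> inv g = (g \<otimes> u \<otimes> inv g) \<otimes> (g \<otimes> v \<otimes> inv g)"
      if "u \<in> carrier G" "v \<in> carrier G" for u v
      using that 2 by (simp add: m_assoc)
    have conj_inv: "g \<otimes> inv u \<otimes> inv g = inv (g \<otimes> u \<otimes> inv g)" if "u \<in> carrier G" for u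
      using that 2 by (simp add: inv_mult_group m_assoc)
    have "g \<otimes> h \<otimes> inv g = (g \<otimes> x \<otimes> inv g) \<otimes> (g \<otimes> y \<otimes> inv g) \<otimes> inv (g \<otimes> x \<otimes> inv g) \<otimes> inv (g \<otimes> y \<otimes> inv g)"
      unfolding xy(3) using x xy(2) by (simp only: conj conj_inv m_closed inv_closed)
    moreover have "g \<otimes> x \<otimes> inv g \<in> lower_central G n"
      using xy(1) 2 by (simp add: N.inv_op_closed2)
    ultimately show ?case
      using xy(2) 2(2) by (intro UN_I[of "g \<otimes> x \<otimes> inv g"] UN_I[of "g \<otimes> y \<otimes> inv g"]) simp_all
  qed
qed

lemma (in group) commutator_in_lower_central:
  assumes "x \<in> lower_central G n" "y \<in> carrier G"
  shows "x \<otimes> y \<otimes> inv x \<otimes> inv y \<in> lower_central G (Suc n)"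
  unfolding lower_central.simps using assms by (intro generate.incl) blast

lemma (in group) lower_central_subgroup:
  assumes "subgroup H G"
  shows "lower_central (G\<lparr>carrier := H\<rparr>) n \<subseteq> lower_central G n"
proof (induction n)
  case 0
  show ?case
    using subgroup.subset[OF assms] by simp
next
  case (Suc n)
  interpret H: group "G\<lparr>carrier := H\<rparr>"
    using assms by (rule subgroup_imp_group)
  have sub: "lower_central (G\<lparr>carrier := H\<rparr>) n \<subseteq> H"
    using subgroup.subset[OF normal_imp_subgroup[OF H.lower_central_normal]] by simp
  show ?case
    unfolding lower_central.simps
  proof (subst generate_consistent[OF _ assms])
    show "generate G (\<Union>x \<in> lower_central (G\<lparr>carrier := H\<rparr>) n. \<Union>y \<in> carrier (G\<lparr>carrier := H\<rparr>).
         {x \<otimes>\<^bsub>G\<lparr>carrier := H\<rparr>\<^esub> y \<otimes>\<^bsub>G\<lparr>carrier := H\<rparr>\<^esub> inv\<^bsub>G\<lparr>carrier := H\<rparr>\<^esub> x \<otimes>\<^bsub>G\<lparr>carrier := H\<rparr>\<^esub> inv\<^bsub>G\<lparr>carrier := H\<rparr>\<^esub> y})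
       \<subseteq> generate G (\<Union>x \<in> lower_central G n. \<Union>y \<in> carrier G. {x \<otimes> y \<otimes> inv x \<otimes> inv y})"
      using sub Suc subgroup.subset[OF assms]
      by (intro mono_generate UN_mono) (auto simp: m_inv_consistent[OF assms] subset_iff)
  qed (use sub in \<open>auto simp: m_inv_consistent[OF assms] subset_iff intro!: subgroup.m_closed[OF assms] subgroup.m_inv_closed[OF assms]\<close>)
qed

text \<open>The lower central series of \<open>H\<close> lies termwise inside that of
  \<open>G\<close>. This passes nilpotency on to the Sylow subgroups.\<close>

lemma nilpotent_group_subgroup:
  fixes G (structure)
  assumes "nilpotent_group G" "subgroup H G"
  shows "nilpotent_group (G\<lparr>carrier := H\<rparr>)"
proof -
  interpret group G
    using assms(1) by (simp add: nilpotent_group_def)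
  interpret H: group "G\<lparr>carrier := H\<rparr>"
    using assms(2) by (rule subgroup_imp_group)
  obtain n where "lower_central G n = {\<one>}"
    using assms(1) by (auto simp: nilpotent_group_def)
  then have "lower_central (G\<lparr>carrier := H\<rparr>) n \<subseteq> {\<one>}"
    using lower_central_subgroup[OF assms(2)] by blast
  moreover have "\<one> \<in> lower_central (G\<lparr>carrier := H\<rparr>) n"
    using H.lower_central_normal normal_imp_subgroup subgroup.one_closed by fastforce
  ultimately show ?thesis
    unfolding nilpotent_group_def using H.is_group by fastforce
qed

text \<open>The commutator \<open>c\<close> descends through the whole series: if it lies in term
  \<open>n\<close>, it is central modulo term \<open>Suc n\<close>, so
  \<open>commute_if_commutator_central_coprime\<close> applies in that quotient and puts
  \<open>c\<close> into term \<open>Suc n\<close>.\<close>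

lemma nilpotent_group_coprime_commute:
  fixes G (structure) and m k :: nat
  assumes nil: "nilpotent_group G" and x: "x \<in> carrier G" and y: "y \<in> carrier G"
    and pow: "x [^] m = \<one>" "y [^] k = \<one>" and "coprime m k"
  shows "x \<otimes> y = y \<otimes> x"
proof -
  interpret group G
    using nil by (simp add: nilpotent_group_def)
  define c where "c = x \<otimes> y \<otimes> inv x \<otimes> inv y"
  have cG: "c \<in> carrier G"
    using x y by (simp add: c_def)
  have "c \<in> lower_central G n" for n
  proof (induction n)
    case (Suc n)
    define N where "N = lower_central G (Suc n)"
    interpret N: normal N G
      unfolding N_def by (rule lower_central_normal)
    interpret \<pi>: group_hom G "G Mod N" "\<lambda>a. N #> a"
      by (simp add: group_hom_def group_hom_axioms_def N.factorgroup_is_group N.r_coset_hom_Mod)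
    have central: "(N #> c) \<otimes>\<^bsub>G Mod N\<^esub> (N #> g) = (N #> g) \<otimes>\<^bsub>G Mod N\<^esub> (N #> c)" if "g \<in> carrier G" for g
    proof -
      have "c \<otimes> g \<otimes> inv c \<otimes> inv g \<in> N"
        unfolding N_def using Suc that by (rule commutator_in_lower_central)
      then have "(c \<otimes> g) \<otimes> inv (g \<otimes> c) \<in> N"
        using cG that by (simp add: inv_mult_group m_assoc)
      then have "N #> (c \<otimes> g) = N #> (g \<otimes> c)"
        using cG that by (metis N.rcos_module_imp N.rcos_module_rev N.subgroup_axioms is_group m_closed repr_independence subgroup.rcos_module_rev)
      then show ?thesis
        using cG that by (simp only: \<pi>.hom_mult[symmetric])
    qed
    have "N #> c = \<one>\<^bsub>G Mod N\<^esub>"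
    proof (rule \<pi>.H.commute_if_commutator_central_coprime[where x = "N #> x" and y = "N #> y"])
      show "N #> c = (N #> x) \<otimes>\<^bsub>G Mod N\<^esub> (N #> y) \<otimes>\<^bsub>G Mod N\<^esub> inv\<^bsub>G Mod N\<^esub> (N #> x) \<otimes>\<^bsub>G Mod N\<^esub> inv\<^bsub>G Mod N\<^esub> (N #> y)"
        unfolding c_def using x y by (simp only: \<pi>.hom_mult \<pi>.hom_inv m_closed inv_closed)
      show "(N #> x) [^]\<^bsub>G Mod N\<^esub> m = \<one>\<^bsub>G Mod N\<^esub>" "(N #> y) [^]\<^bsub>G Mod N\<^esub> k = \<one>\<^bsub>G Mod N\<^esub>"
        using x y pow \<pi>.hom_one by (simp_all only: \<pi>.hom_nat_pow[symmetric])
    qed (use x y central \<open>coprime m k\<close> \<pi>.hom_closed in simp_all)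
    then have "N #> c = N"
      by (simp add: FactGroup_def)
    then show ?case
      unfolding N_def[symmetric] using cG N.subgroup_axioms rcos_self by metis
  qed (use cG in simp)
  then have "c = \<one>"
    using nil by (auto simp: nilpotent_group_def)
  moreover have "x \<otimes> y = c \<otimes> (y \<otimes> x)"
    using x y by (simp add: c_def m_assoc)
  ultimately show ?thesis
    using x y by simp
qed

section \<open>Induced paths from elements of prime order\<close>

lemma (in group) prime_ord_generated_by_power:
  fixes j :: int
  assumes x: "x \<in> carrier G" "Factorial_Ring.prime (ord x)" and ne: "x [^] j \<noteq> \<one>"
  shows "\<exists>k::int. (x [^] j) [^] k = x"
proof -
  have "\<not> int (ord x) dvd j"
    using int_pow_eq_id[OF x(1), of j] ne by auto
  then have "coprime (int (ord x)) j"
    using x(2) by (simp add: prime_imp_coprime)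
  then obtain s t where "s * int (ord x) + t * j = 1"
    by (metis bezout_int coprime_iff_gcd_eq_1)
  then have "int (ord x) dvd 1 - j * t"
    by (metis add_diff_cancel_right' dvd_triv_right mult.commute)
  then have "x [^] (j * t) = x [^] (1::int)"
    using int_pow_eq[OF x(1)] by blast
  then show ?thesis
    using x(1) by (intro exI[of _ t]) (simp add: int_pow_pow)
qed

text \<open>The exponent \<open>ord z\<close> removes \<open>z\<close> from
  \<open>x \<otimes> z\<close> and leaves a non-trivial power of \<open>x\<close>, from which
  \<open>x\<close> is recovered since its order is prime.\<close>

lemma (in group) mem_generate_mult_prime_ord:
  assumes x: "x \<in> carrier G" "Factorial_Ring.prime (ord x)" and z: "z \<in> carrier G" "Factorial_Ring.prime (ord z)"
    and xz: "ord z \<noteq> ord x" "x \<otimes> z = z \<otimes> x"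
  shows "x \<in> generate G {x \<otimes> z}"
proof -
  let ?r = "int (ord z)"
  have "(x \<otimes> z) [^] ?r = x [^] ?r \<otimes> z [^] ?r"
    using x z xz by (intro int_pow_mult_distrib) simp_all
  moreover have "z [^] ?r = \<one>"
    using z by (simp add: int_pow_int pow_ord_eq_1)
  ultimately have xz_pow: "(x \<otimes> z) [^] ?r = x [^] ?r"
    using x by simp
  have "x [^] ?r \<noteq> \<one>"
    using x z xz(1) primes_dvd_imp_eq[of "ord x" "ord z"] by (auto simp: int_pow_eq_id[OF x(1)])
  then obtain k :: int where "(x [^] ?r) [^] k = x"
    using prime_ord_generated_by_power[OF x] by blast
  then have "(x \<otimes> z) [^] (?r * k) = x"
    using x z xz_pow by (simp flip: int_pow_pow)
  then show ?thesis
    using generate_pow[OF m_closed[OF x(1) z(1)]] by (metis (mono_tags, lifting) UNIV_I mem_Collect_eq)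
qed

text \<open>If \<open>w = (x z)^k = y^l\<close>, the exponent \<open>ord y * ord x\<close> kills
  \<open>w\<close> and the \<open>x\<close>-part, hence the \<open>z\<close>-part, which forces
  \<open>ord z\<close> to divide \<open>k\<close>. Then \<open>w = x^k\<close> lies in both
  \<open><x>\<close> and \<open><y>\<close>.\<close>

lemma (in group) generate_mult_prime_ord_Int:
  assumes x: "x \<in> carrier G" and y: "y \<in> carrier G"
    and z: "z \<in> carrier G" "Factorial_Ring.prime (ord z)"
    and "\<not> ord z dvd ord x" "\<not> ord z dvd ord y" and xz: "x \<otimes> z = z \<otimes> x"
    and xy: "generate G {x} \<inter> generate G {y} = {\<one>}"
  shows "generate G {x \<otimes> z} \<inter> generate G {y} = {\<one>}"
proof -
  have "w = \<one>" if w: "w \<in> generate G {x \<otimes> z}" "w \<in> generate G {y}" for w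
  proof -
    obtain k l :: int where kl: "w = (x \<otimes> z) [^] k" "w = y [^] l"
      using w unfolding generate_pow[OF m_closed[OF x z(1)]] generate_pow[OF y] by blast
    let ?n = "int (ord y) * int (ord x)"
    have pow: "(x \<otimes> z) [^] i = x [^] i \<otimes> z [^] i" for i :: int
      using x z xz by (intro int_pow_mult_distrib) simp_all
    have "w [^] ?n = \<one>"
      using y int_pow_eq_id[OF y, of "l * ?n"] by (simp add: kl(2) int_pow_pow)
    then have "x [^] (k * ?n) \<otimes> z [^] (k * ?n) = \<one>"
      unfolding kl(1) using x z by (simp add: int_pow_pow flip: pow)
    moreover have "x [^] (k * ?n) = \<one>"
      using int_pow_eq_id[OF x, of "k * ?n"] by simp
    ultimately have "int (ord z) dvd k * ?n"
      using z int_pow_eq_id[OF z(1), of "k * ?n"] by simp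
    then have "int (ord z) dvd k"
      using z(2) assms(5,6) by (simp add: prime_dvd_mult_iff)
    then have "z [^] k = \<one>"
      using int_pow_eq_id[OF z(1), of k] by simp
    then have "w = x [^] k"
      using x z by (simp add: kl(1) pow)
    then have "w \<in> generate G {x}"
      using x by (auto simp: generate_pow)
    then show ?thesis
      using w xy by blast
  qed
  then show ?thesis
    using generate.one by blast
qed

text \<open>The non-edges of the path come from shared elements: \<open>y\<close> lies in
  \<open><yz>\<close> and \<open><y>\<close>, \<open>x\<close> in \<open><x>\<close> and
  \<open><xz>\<close>, and \<open>z\<close> in both ends. The inner edge holds because distinct
  subgroups of prime order meet trivially, and \<open>generate_mult_prime_ord_Int\<close> extends
  this to the outer edges.\<close>

lemma (in group) not_cograph_if_three_prime_orders:
  assumes x: "x \<in> carrier G" "Factorial_Ring.prime (ord x)" and y: "y \<in> carrier G" "Factorial_Ring.prime (ord y)"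
    and z: "z \<in> carrier G" "Factorial_Ring.prime (ord z)"
    and ord: "ord z \<noteq> ord x" "ord z \<noteq> ord y" and comm: "x \<otimes> z = z \<otimes> x" "y \<otimes> z = z \<otimes> y"
    and xy: "y \<notin> generate G {x}"
  shows "\<not> cograph (with_proj (intersection_subgroup_graph G))"
proof -
  have XY: "generate G {x} \<inter> generate G {y} = {\<one>}"
  proof -
    have "w = \<one>" if w: "w \<in> generate G {x}" "w \<in> generate G {y}" for w
    proof (rule ccontr)
      assume "w \<noteq> \<one>"
      obtain j :: int where "w = y [^] j"
        using w(2) unfolding generate_pow[OF y(1)] by blast
      then obtain k :: int where "w [^] k = y"
        using prime_ord_generated_by_power[OF y] \<open>w \<noteq> \<one>\<close> by blast
      then show False
        using xy w(1) subgroup_int_pow_closed[OF generate_is_subgroup, of "{x}" w k] x by simp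
    qed
    then show ?thesis
      using generate.one by blast
  qed
  have ndvd: "\<not> ord z dvd ord x" "\<not> ord z dvd ord y"
    using x y z ord primes_dvd_imp_eq by blast+
  have I: "generate G {x \<otimes> z} \<inter> generate G {y} = {\<one>}" "generate G {y \<otimes> z} \<inter> generate G {x} = {\<one>}"
    using generate_mult_prime_ord_Int[of x y z] generate_mult_prime_ord_Int[of y x z] x y z ndvd comm XY
    by (simp_all add: Int_commute)
  have mem: "x \<in> generate G {x \<otimes> z}" "y \<in> generate G {y \<otimes> z}" "z \<in> generate G {x \<otimes> z}" "z \<in> generate G {y \<otimes> z}"
    using mem_generate_mult_prime_ord[of x z] mem_generate_mult_prime_ord[of y z]
      mem_generate_mult_prime_ord[of z x] mem_generate_mult_prime_ord[of z y] x y z ord comm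
    by simp_all
  have self: "x \<in> generate G {x}" "y \<in> generate G {y}"
    by (auto intro: generate.incl)
  have "u \<noteq> \<one>" if "u \<in> carrier G" "Factorial_Ring.prime (ord u)" for u
    using that ord_eq_1 by (metis not_prime_1)
  then have ne: "x \<noteq> \<one>" "y \<noteq> \<one>" "z \<noteq> \<one>"
    using x y z by blast+
  have sub: "subgroup (generate G {u}) G" if "u \<in> carrier G" for u
    using that generate_is_subgroup by simp
  \<comment> \<open>The second subgroup plays the role of the \<open>K\<close> that makes the first
    one a vertex; the primed elements witness non-triviality.\<close>
  have vert: "generate G {u} \<in> isg_verts G"
    if "u \<in> carrier G" "v \<in> carrier G" "generate G {u} \<inter> generate G {v} = {\<one>}"
      "u' \<in> generate G {u}" "u' \<noteq> \<one>" "v' \<in> generate G {v}" "v' \<noteq> \<one>" for u v u' v'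
    unfolding isg_verts_def using that sub by blast
  have V: "generate G {y \<otimes> z} \<in> isg_verts G" "generate G {x} \<in> isg_verts G"
      "generate G {y} \<in> isg_verts G" "generate G {x \<otimes> z} \<in> isg_verts G"
    using vert[of "y \<otimes> z" x y x] vert[of x y x y] vert[of y x y x] vert[of "x \<otimes> z" y x y]
      x y z I XY mem self ne by (simp_all add: Int_commute)
  show ?thesis
    unfolding not_cograph_iff_P4
  proof (intro bexI conjI)
    show "generate G {y \<otimes> z} \<inter> generate G {x} = {\<one>}" "generate G {x} \<inter> generate G {y} = {\<one>}"
      "generate G {y} \<inter> generate G {x \<otimes> z} = {\<one>}"
      using I XY by (simp_all add: Int_commute)
    show "generate G {y \<otimes> z} \<inter> generate G {y} \<noteq> {\<one>}" "generate G {x} \<inter> generate G {x \<otimes> z} \<noteq> {\<one>}"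
      "generate G {y \<otimes> z} \<inter> generate G {x \<otimes> z} \<noteq> {\<one>}"
      using mem self ne by blast+
  qed (use V in blast)+
qed

section \<open>Groups of prime power order with a unique subgroup of prime order\<close>

text \<open>Modulo \<open>p^2\<close> the power \<open>r^j\<close> is \<open>1 + j (r - 1)\<close>,
  and the numbers below an odd \<open>p\<close> have a sum divisible by \<open>p\<close>, so the
  geometric sum is \<open>p\<close> modulo \<open>p^2\<close>. For \<open>p = 2\<close> it is
  \<open>1 + r\<close>, which is 2 modulo 4 when 4 divides \<open>r - 1\<close>.\<close>

lemma geometric_sum_eq_prime_times_coprime:
  fixes p :: nat and r :: int
  assumes p: "Factorial_Ring.prime p" and r: "int p dvd r - 1" "odd p \<or> 4 dvd r - 1"
  shows "\<exists>u. (\<Sum>j<p. r ^ j) = int p * u \<and> coprime u (int p)"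
proof (cases "odd p")
  case True
  obtain v where v: "r = 1 + int p * v"
    using r(1) by (metis dvd_def diff_add_cancel add.commute)
  have "\<exists>w. r ^ j = 1 + int j * (int p * v) + (int p)\<^sup>2 * w" for j :: nat
  proof (induction j)
    case 0
    show ?case
      by (intro exI[of _ 0]) simp
  next
    case (Suc j)
    then obtain w where "r ^ j = 1 + int j * (int p * v) + (int p)\<^sup>2 * w"
      by blast
    then have "r ^ Suc j = 1 + int (Suc j) * (int p * v) + (int p)\<^sup>2 * (int j * v * v + w + w * int p * v)"
      by (simp add: v algebra_simps power2_eq_square)
    then show ?case
      by blast
  qed
  then obtain w where w: "\<And>j. r ^ j = 1 + int j * (int p * v) + (int p)\<^sup>2 * w j"
    by metis
  \<comment> \<open>\<open>h\<close> is \<open>(p - 1) / 2\<close>, so the numbers below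
    \<open>p\<close> sum to \<open>p * h\<close>.\<close>
  obtain h where h: "p = Suc (2 * h)"
    using True by (metis oddE Suc_eq_plus1)
  have "2 * (\<Sum>j<m. int j) = int m * (int m - 1)" for m :: nat
    by (induction m) (simp_all add: algebra_simps)
  from this[of p] have "(\<Sum>j<p. int j) = int p * int h"
    by (simp add: h algebra_simps)
  then have "(\<Sum>j<p. r ^ j) = int p + int p * int h * (int p * v) + (int p)\<^sup>2 * (\<Sum>j<p. w j)"
    by (simp add: w sum.distrib flip: sum_distrib_left sum_distrib_right)
  also have "\<dots> = int p * (1 + int p * (int h * v + (\<Sum>j<p. w j)))"
    by (simp add: algebra_simps power2_eq_square)
  finally have "(\<Sum>j<p. r ^ j) = int p * (1 + int p * (int h * v + (\<Sum>j<p. w j)))" .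
  moreover have "coprime (1 + int p * c) (int p)" for c
    by (rule coprimeI) (metis dvd_add_left_iff dvd_mult2)
  ultimately show ?thesis
    by blast
next
  case False
  then have "p = 2"
    using p by (metis prime_odd_nat prime_ge_2_nat le_neq_implies_less)
  obtain v where "r = 1 + 4 * v"
    using r(2) False by (metis dvd_def diff_add_cancel add.commute)
  then have "(\<Sum>j<p. r ^ j) = int p * (1 + 2 * v)"
    by (simp add: \<open>p = 2\<close> numeral_2_eq_2 lessThan_Suc)
  moreover have "coprime (1 + 2 * v) 2"
    by simp
  ultimately show ?thesis
    using \<open>p = 2\<close> by (intro exI[of _ "1 + 2 * v"]) simp
qed

lemma prime_dvd_diff_1_if_power_prime:
  fixes p :: nat and r :: int
  assumes "Factorial_Ring.prime p" and "int p dvd r ^ p - 1"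
  shows "int p dvd r - 1"
proof -
  have "\<not> int p dvd r"
    using assms by (metis dvd_diff_commute dvd_power dvd_diff_right_iff dvd_trans not_prime_unit prime_gt_0_nat prime_nat_int_transfer)
  \<comment> \<open>Fermat's theorem is applied to a natural number, the least non-negative residue
    of \<open>r\<close>; it yields that \<open>r ^ p\<close> is congruent to
    \<open>r\<close>.\<close>
  define m where "m = nat (r mod int p)"
  have p: "p > 0"
    using assms(1) prime_gt_0_nat by blast
  then have m: "int m = r mod int p"
    by (simp add: m_def)
  then have "[int m = r] (mod int p)"
    by (simp add: cong_def)
  then have "\<not> p dvd m"
    using \<open>\<not> int p dvd r\<close> by (metis cong_dvd_iff int_dvd_int_iff)
  then have "[m ^ (p - 1) = 1] (mod p)"
    using assms(1) by (rule fermat_theorem[rotated])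
  then have "[int m ^ (p - 1) = 1] (mod int p)"
    by (metis cong_int_iff of_nat_1 of_nat_power)
  then have "[r ^ (p - 1) = 1] (mod int p)"
    using \<open>[int m = r] (mod int p)\<close> by (meson cong_pow cong_sym cong_trans)
  then have "[r * r ^ (p - 1) = r * 1] (mod int p)"
    by (rule cong_scalar_left)
  moreover have "r * r ^ (p - 1) = r ^ p"
    using p by (metis power_minus_mult mult.commute)
  ultimately have "[r ^ p = r] (mod int p)"
    by simp
  moreover have "[r ^ p = 1] (mod int p)"
    using assms(2) by (simp add: cong_iff_dvd_diff)
  ultimately show ?thesis
    by (metis cong_iff_dvd_diff cong_sym cong_trans)
qed

section \<open>Powers under conjugation\<close>

context group
begin

lemma mem_generate_iff_int_pow:
  "x \<in> carrier G \<Longrightarrow> w \<in> generate G {x} \<longleftrightarrow> (\<exists>k::int. w = x [^] k)"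
  by (auto simp: generate_pow)

lemma conj_mult:
  assumes "y \<in> carrier G" "u \<in> carrier G" "v \<in> carrier G"
  shows "y \<otimes> (u \<otimes> v) \<otimes> inv y = (y \<otimes> u \<otimes> inv y) \<otimes> (y \<otimes> v \<otimes> inv y)"
  using assms by (simp add: m_assoc)

lemma conj_int_pow:
  assumes "y \<in> carrier G" "x \<in> carrier G"
  shows "y \<otimes> x [^] (m::int) \<otimes> inv y = (y \<otimes> x \<otimes> inv y) [^] m"
proof -
  interpret c: group_hom G G "\<lambda>g. y \<otimes> g \<otimes> inv y"
    using assms(1) by unfold_locales (auto simp: hom_def conj_mult)
  show ?thesis
    using c.hom_int_pow[OF assms(2)] .
qed

lemma conj_eq_int_pow_imp_swap:
  assumes "y \<in> carrier G" "x \<in> carrier G" "y \<otimes> x \<otimes> inv y = x [^] (r::int)"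
  shows "y \<otimes> x [^] (m::int) = x [^] (r * m) \<otimes> y"
proof -
  have "y \<otimes> x [^] m \<otimes> inv y = x [^] (r * m)"
    using assms by (simp add: conj_int_pow int_pow_pow)
  then show ?thesis
    using assms by (metis inv_solve_right' int_pow_closed m_closed)
qed

lemma nat_pow_swap:
  fixes i :: nat
  assumes "y \<in> carrier G" "x \<in> carrier G" "y \<otimes> x \<otimes> inv y = x [^] (r::int)"
  shows "y [^] i \<otimes> x = x [^] (r ^ i) \<otimes> y [^] i"
proof (induction i)
  case (Suc i)
  have "y [^] Suc i \<otimes> x = y \<otimes> (y [^] i \<otimes> x)"
    using assms by (simp only: nat_pow_Suc2 m_assoc nat_pow_closed)
  also have "\<dots> = (y \<otimes> x [^] (r ^ i)) \<otimes> y [^] i"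
    using assms by (simp add: Suc m_assoc)
  also have "\<dots> = x [^] (r ^ Suc i) \<otimes> (y \<otimes> y [^] i)"
    using assms by (simp add: conj_eq_int_pow_imp_swap m_assoc)
  finally show ?case
    using assms by (simp only: nat_pow_Suc2)
qed (use assms in simp)

text \<open>Moving one \<open>y\<close> to the right across a power of \<open>x\<close> multiplies
  the exponent by \<open>r\<close>, so the exponents of \<open>x\<close> accumulate to a geometric
  sum. Its divisibility governs the case analysis below.\<close>

lemma twisted_nat_pow:
  fixes i :: nat and k :: int
  assumes "y \<in> carrier G" "x \<in> carrier G" "y \<otimes> x \<otimes> inv y = x [^] (r::int)"
  shows "(x [^] k \<otimes> y) [^] i = x [^] (k * (\<Sum>j<i. r ^ j)) \<otimes> y [^] i"
proof (induction i)
  case (Suc i)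
  have "(x [^] k \<otimes> y) [^] Suc i = x [^] k \<otimes> (y \<otimes> x [^] (k * (\<Sum>j<i. r ^ j))) \<otimes> y [^] i"
    using assms by (simp only: nat_pow_Suc2 Suc m_closed int_pow_closed nat_pow_closed) (simp add: m_assoc)
  also have "\<dots> = x [^] (k + r * (k * (\<Sum>j<i. r ^ j))) \<otimes> (y \<otimes> y [^] i)"
    using assms by (simp add: conj_eq_int_pow_imp_swap int_pow_mult m_assoc)
  also have "k + r * (k * (\<Sum>j<i. r ^ j)) = k * (\<Sum>j<Suc i. r ^ j)"
    by (simp add: sum.lessThan_Suc_shift sum_distrib_left algebra_simps del: sum.lessThan_Suc)
  finally show ?case
    using assms by (simp only: nat_pow_Suc2)
qed (use assms in simp)

end

text \<open>A \<open>p\<close>-group with at most one subgroup of order \<open>p\<close>, phrased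
  through elements. The instances are Sylow subgroups, taken as groups with restricted
  carrier.\<close>

locale unique_prime_subgroup = group G for G (structure) +
  fixes p :: nat
  assumes prime_p: "Factorial_Ring.prime p"
    and ord_prime_power: "x \<in> carrier G \<Longrightarrow> \<exists>k. ord x = p ^ k"
    and unique: "\<lbrakk>u \<in> carrier G; v \<in> carrier G; ord u = p; ord v = p\<rbrakk> \<Longrightarrow> v \<in> generate G {u}"
begin

lemma ord_eq_p: "x \<in> carrier G \<Longrightarrow> x \<noteq> \<one> \<Longrightarrow> x [^] p = \<one> \<Longrightarrow> ord x = p"
  using prime_p pow_eq_id ord_eq_1 by (metis prime_nat_iff)

lemma p_dvd_ord: "x \<in> carrier G \<Longrightarrow> x \<noteq> \<one> \<Longrightarrow> p dvd ord x"
  using ord_prime_power[of x] ord_eq_1[of x] by (metis dvd_power gr0I power_0)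

lemma ord_pos: "x \<in> carrier G \<Longrightarrow> ord x > 0"
  using ord_prime_power[of x] prime_p prime_gt_0_nat by force

text \<open>The power of \<open>x\<close> with exponent \<open>ord x div p\<close> has order
  \<open>p\<close>, so by uniqueness it generates \<open>w\<close>.\<close>

lemma order_p_in_cyclic:
  assumes x: "x \<in> carrier G" "x \<noteq> \<one>" and w: "w \<in> carrier G" "w [^] p = \<one>"
  shows "w \<in> generate G {x}"
proof (cases "w = \<one>")
  case True
  then show ?thesis
    by (simp add: generate.one)
next
  case False
  have dvd: "ord x div p dvd ord x" "ord x div p \<noteq> 0" "ord x div (ord x div p) = p"
    using p_dvd_ord[OF x] ord_pos[OF x(1)] by (auto simp: div_dvd_iff_mult elim!: dvdE)
  then have "ord (x [^] (ord x div p)) = p"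
    using ord_pow[OF x(1)] by simp
  then have "w \<in> generate G {x [^] (ord x div p)}"
    using unique ord_eq_p w x False by simp
  moreover have "x [^] (ord x div p) \<in> generate G {x}"
    using x(1) mem_generate_iff_int_pow by (metis int_pow_int)
  ultimately show ?thesis
    using generate_subgroup_incl[of "{x [^] (ord x div p)}" "generate G {x}"] generate_is_subgroup[of "{x}"] x(1) by auto
qed

section \<open>The action of \<open>y\<close> on a cyclic subgroup containing
  \<open>y^p\<close>\<close>

context
  fixes x y :: 'a and r s :: int
  assumes x: "x \<in> carrier G" "x \<noteq> \<one>" and y: "y \<in> carrier G" "y \<notin> generate G {x}" "x \<notin> generate G {y}"
    and conj: "y \<otimes> x \<otimes> inv y = x [^] r" and pow: "y [^] p = x [^] s"
begin

text \<open>This number is the exponent of \<open>x\<close> in \<open>(x^k y)^p\<close>. Were that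
  power trivial, \<open>x^k y\<close> would lie in \<open><x>\<close> by
  \<open>order_p_in_cyclic\<close>, and then so would \<open>y\<close>. Every \<open>k\<close> thus
  constrains \<open>r\<close> and \<open>s\<close>.\<close>

lemma not_dvd_twisted: "\<not> int (ord x) dvd k * (\<Sum>j<p. r ^ j) + s"
proof
  assume "int (ord x) dvd k * (\<Sum>j<p. r ^ j) + s"
  then have "(x [^] k \<otimes> y) [^] p = \<one>"
    using x y by (simp add: twisted_nat_pow[OF y(1) x(1) conj] pow int_pow_eq_id flip: int_pow_mult)
  then have "x [^] k \<otimes> y \<in> generate G {x}"
    using x y by (intro order_p_in_cyclic) simp_all
  then obtain l :: int where "x [^] k \<otimes> y = x [^] l"
    using x by (auto simp: mem_generate_iff_int_pow)
  then have "y = x [^] (l - k)"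
    using x(1) y(1) by (metis add.commute diff_conv_add_uminus inv_solve_left int_pow_closed int_pow_mult int_pow_neg)
  then show False
    using x y by (auto simp: mem_generate_iff_int_pow)
qed

text \<open>Otherwise \<open>s\<close> is invertible modulo the prime power \<open>ord x\<close>,
  and \<open>x\<close> is a power of \<open>x^s = y^p\<close>, although \<open>x\<close> lies
  outside \<open><y>\<close>.\<close>

lemma p_dvd_exponent: "int p dvd s"
proof (rule ccontr)
  assume "\<not> int p dvd s"
  then have "coprime (int p) s"
    using prime_p by (simp add: prime_imp_coprime)
  moreover obtain e where "ord x = p ^ e"
    using ord_prime_power x by blast
  ultimately have "coprime (int (ord x)) s"
    by simp
  then obtain m n where "m * int (ord x) + n * s = 1"
    by (metis bezout_int coprime_iff_gcd_eq_1)
  then have "int (ord x) dvd 1 - s * n"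
    by (metis add_diff_cancel_right' dvd_triv_right mult.commute)
  then have "x [^] (s * n) = x [^] (1::int)"
    using int_pow_eq[OF x(1)] by blast
  then have "x = y [^] (int p * n)"
    using x y(1) pow by (simp add: int_pow_int flip: int_pow_pow)
  then show False
    using y by (auto simp: mem_generate_iff_int_pow)
qed

text \<open>Write \<open>s = p t\<close>. If the sum were \<open>p u\<close>, then
  \<open>k p u + p t\<close> would vanish modulo \<open>ord x\<close> for some \<open>k\<close>,
  since \<open>u\<close> is invertible there; this contradicts
  \<open>not_dvd_twisted\<close>.\<close>

lemma geometric_sum_not_prime_times_coprime:
  assumes "coprime u (int p)"
  shows "(\<Sum>j<p. r ^ j) \<noteq> int p * u"
proof
  assume \<sigma>: "(\<Sum>j<p. r ^ j) = int p * u"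
  obtain e where "ord x = p ^ e"
    using ord_prime_power x by blast
  then have "coprime u (int (ord x))"
    using assms by simp
  then obtain m n where mn: "m * u + n * int (ord x) = 1"
    by (metis bezout_int coprime_iff_gcd_eq_1)
  obtain t where t: "s = int p * t"
    using p_dvd_exponent by blast
  \<comment> \<open>\<open>m\<close> inverts \<open>u\<close> modulo \<open>ord x\<close>, so
    \<open>- t * m\<close> is the offending \<open>k\<close>.\<close>
  have "- t * m * (\<Sum>j<p. r ^ j) + s = int p * t * (1 - m * u)"
    by (simp add: \<sigma> t algebra_simps)
  also have "1 - m * u = n * int (ord x)"
    using mn by simp
  finally show False
    using not_dvd_twisted[of "- t * m"] by simp
qed

text \<open>Conjugation by \<open>y^p\<close> sends \<open>x\<close> to \<open>x^(r^p)\<close>, but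
  \<open>y^p\<close> is a power of \<open>x\<close> and acts trivially.\<close>

lemma ord_dvd_power_minus_1: "int (ord x) dvd r ^ p - 1"
proof -
  have "x [^] (r ^ p) \<otimes> x [^] s = x [^] s \<otimes> x"
    using nat_pow_swap[OF y(1) x(1) conj, of p] by (simp add: pow)
  also have "\<dots> = x [^] (1::int) \<otimes> x [^] s"
    using x(1) by (simp add: add.commute flip: int_pow_mult int_pow_one)
      (metis add.commute int_pow_1 int_pow_mult)
  finally have "x [^] (r ^ p) = x [^] (1::int)"
    using x(1) by (metis int_pow_closed r_cancel)
  then have "int (ord x) dvd 1 - r ^ p"
    using int_pow_eq[OF x(1)] by blast
  then show ?thesis
    by (simp add: dvd_diff_commute)
qed

text \<open>\<open>p\<close> divides \<open>ord x\<close> and so \<open>r ^ p - 1\<close>, hence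
  \<open>r - 1\<close> by Fermat. For odd \<open>p\<close>, or for \<open>r\<close> congruent to 1
  modulo 4, the geometric sum would then be \<open>p\<close> times a number prime to
  \<open>p\<close>, which is excluded.\<close>

lemma p_eq_2: "p = 2" and not_1_mod_4: "\<not> 4 dvd r - 1" and odd_r: "odd r"
proof -
  have "int p dvd r - 1"
  proof (rule prime_dvd_diff_1_if_power_prime[OF prime_p])
    have "int p dvd int (ord x)"
      using p_dvd_ord[OF x] by (simp only: int_dvd_int_iff)
    then show "int p dvd r ^ p - 1"
      using ord_dvd_power_minus_1 by (rule dvd_trans)
  qed
  then have "\<not> (odd p \<or> 4 dvd r - 1)"
    using geometric_sum_eq_prime_times_coprime[OF prime_p, of r] geometric_sum_not_prime_times_coprime
    by metis
  then have "even p" and 4: "\<not> 4 dvd r - 1"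
    by simp_all
  then show "p = 2"
    using prime_p by (metis prime_odd_nat prime_ge_2_nat le_neq_implies_less)
  then show "odd r"
    using \<open>int p dvd r - 1\<close> by simp
  show "\<not> 4 dvd r - 1"
    by (rule 4)
qed

text \<open>\<open>r - 1\<close> is twice an odd number. Hence \<open>s\<close> is determined up to
  one bit since \<open>y\<close> commutes with \<open>y^2 = x^s\<close>, and \<open>r\<close> since
  \<open>y^2\<close> commutes with \<open>x\<close>. The remaining bits are settled by
  \<open>not_dvd_twisted\<close> with \<open>k = 0\<close> and \<open>k = 1\<close>.\<close>

lemma noncyclic_relations:
  shows "\<exists>e\<ge>2. ord x = 2 ^ e \<and> y [^] (2::nat) = x [^] (2 ^ (e - 1) :: nat) \<and> y \<otimes> x \<otimes> inv y = inv x"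
proof -
  obtain e where e: "ord x = 2 ^ e"
    using ord_prime_power x p_eq_2 by blast
  have "e \<noteq> 0"
    using e x ord_eq_1[OF x(1)] by (intro notI) simp
  \<comment> \<open>Half the order of \<open>x\<close> is \<open>2 ^ d\<close>, so
    \<open>x^(2^d)\<close> is the involution of \<open><x>\<close>.\<close>
  then obtain d where d: "e = Suc d"
    using not0_implies_Suc by blast
  have ord: "int (ord x) = 2 * 2 ^ d"
    by (simp add: e d)
  obtain h where h: "r - 1 = 2 * h" "odd h"
    using odd_r not_1_mod_4 by (metis (no_types, opaque_lifting) dvd_mult_cancel_left dvdE even_add odd_one diff_add_cancel mult_2_right numeral_Bit0_eq_double)
  have cop: "coprime ((2::int) ^ d) h"
    using h(2) by simp
  have "x [^] (r * s) \<otimes> y = y \<otimes> x [^] s"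
    using conj_eq_int_pow_imp_swap[OF y(1) x(1) conj, of s] by simp
  also have "\<dots> = x [^] s \<otimes> y"
    using y(1) by (simp flip: pow add: nat_pow_comm) (metis nat_pow_Suc nat_pow_Suc2)
  finally have "x [^] (r * s) = x [^] s"
    using x(1) y(1) by simp
  then have "int (ord x) dvd s - r * s"
    using int_pow_eq[OF x(1)] by blast
  also have "s - r * s = - (2 * (h * s))"
    using h(1) by (simp add: algebra_simps)
  finally have "2 ^ d dvd h * s"
    by (simp add: ord)
  then obtain t where t: "s = 2 ^ d * t"
    using cop by (metis coprime_dvd_mult_right_iff dvdE)
  \<comment> \<open>The case \<open>k = 0\<close>: \<open>y^2\<close> is non-trivial, which makes it
    the involution.\<close>
  have "\<not> int (ord x) dvd s"
    using not_dvd_twisted[of 0] by simp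
  then have "odd t"
    by (auto simp: ord t elim!: evenE)
  then have s: "x [^] s = x [^] ((2::int) ^ d)"
    unfolding int_pow_eq[OF x(1)] ord t by (auto elim!: oddE simp: algebra_simps)
  \<comment> \<open>\<open>p = 2\<close> divides \<open>s = 2 ^ d * t\<close> with \<open>t\<close>
    odd; this yields \<open>e \<ge> 2\<close>.\<close>
  have "d \<noteq> 0"
    using p_dvd_exponent \<open>odd t\<close> by (auto simp: p_eq_2 t)
  have "int (ord x) dvd (r - 1) * (r + 1)"
    using ord_dvd_power_minus_1 by (simp add: p_eq_2 power2_eq_square algebra_simps)
  then have "2 ^ d dvd h * (r + 1)"
    by (simp add: ord h(1) mult.assoc)
  then obtain c where c: "r + 1 = 2 ^ d * c"
    using cop by (metis coprime_dvd_mult_right_iff dvdE)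
  \<comment> \<open>The case \<open>k = 1\<close>: the exponent of \<open>(x y)^2\<close> is
    \<open>1 + r + s = 2 ^ d * (c + t)\<close>, a multiple of \<open>ord x\<close> if
    \<open>c\<close> and \<open>t\<close> are both odd.\<close>
  have "even c"
  proof (rule ccontr)
    assume "odd c"
    have "int (ord x) dvd 1 * (\<Sum>j<p. r ^ j) + s"
      using \<open>odd t\<close> \<open>odd c\<close> c by (auto simp: p_eq_2 numeral_2_eq_2 ord t add.commute[of 1] simp flip: distrib_left)
    then show False
      using not_dvd_twisted by blast
  qed
  then have "int (ord x) dvd - 1 - r"
  proof -
    obtain b where "c = 2 * b"
      using \<open>even c\<close> by (rule evenE)
    then have "- 1 - r = int (ord x) * (- b)"
      using c by (simp add: ord algebra_simps)
    then show ?thesis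
      by (rule dvdI)
  qed
  then have "x [^] r = x [^] (- 1 :: int)"
    using int_pow_eq[OF x(1)] by blast
  then have "y \<otimes> x \<otimes> inv y = inv x"
    using x(1) conj int_pow_neg[of x 1] by simp
  moreover have "y [^] (2::nat) = x [^] (2 ^ (e - 1) :: nat)"
  proof -
    have "x [^] ((2::int) ^ d) = x [^] (2 ^ d :: nat)"
      using int_pow_int[of G x "2 ^ d"] by simp
    then show ?thesis
      using pow s by (simp add: p_eq_2 d)
  qed
  ultimately show ?thesis
    using e d \<open>d \<noteq> 0\<close> by (intro exI[of _ e]) auto
qed

end

end

section \<open>Maximal normal cyclic subgroups\<close>

lemma (in group) inv_swap:
  assumes "a \<in> carrier G" "b \<in> carrier G" "c \<in> carrier G" and "a \<otimes> b = c \<otimes> a"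
  shows "inv a \<otimes> c = b \<otimes> inv a"
proof -
  have "inv a \<otimes> c = inv a \<otimes> (c \<otimes> a) \<otimes> inv a"
    using assms(1-3) by (simp add: m_assoc)
  also have "\<dots> = b \<otimes> inv a"
    unfolding assms(4)[symmetric] using assms(1,2) by simp
  finally show ?thesis .
qed

text \<open>Repeated \<open>p\<close>-th powers of \<open>y\<close> end at the identity, so one of
  these steps enters \<open>H\<close>. This replaces an element outside \<open>H\<close> by one
  whose \<open>p\<close>-th power is inside.\<close>

lemma (in unique_prime_subgroup) power_leaving_subgroup:
  assumes "subgroup H G" and y: "y \<in> carrier G" "y \<notin> H"
  obtains i where "y [^] (p ^ i) \<notin> H" "y [^] (p ^ Suc i) \<in> H"
proof -
  obtain k where "ord y = p ^ k"
    using ord_prime_power y by blast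
  then have "y [^] (p ^ k) = \<one>"
    using pow_ord_eq_1[OF y(1)] by simp
  then have k: "y [^] (p ^ k) \<in> H"
    using assms(1) subgroup.one_closed by metis
  have "y [^] (p ^ 0) \<notin> H"
    using y by simp
  then obtain i where "y [^] (p ^ i) \<notin> H" "y [^] (p ^ Suc i) \<in> H"
    using k by (induction k) blast+
  then show ?thesis
    by (rule that)
qed

text \<open>If \<open>x\<close> were outside \<open><z>\<close>, \<open>not_1_mod_4\<close> would
  apply with \<open>r = 1\<close> and deny that 4 divides \<open>1 - 1\<close>.\<close>

lemma (in unique_prime_subgroup) commuting_in_generate:
  assumes x: "x \<in> carrier G" and z: "z \<in> carrier G" "z \<notin> generate G {x}" "z [^] p \<in> generate G {x}"
    and comm: "z \<otimes> x = x \<otimes> z"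
  shows "x \<in> generate G {z}"
proof (rule ccontr)
  assume nx: "x \<notin> generate G {z}"
  then have "x \<noteq> \<one>"
    using generate.one by metis
  moreover obtain s :: int where "z [^] p = x [^] s"
    using z x by (auto simp: mem_generate_iff_int_pow)
  moreover have "z \<otimes> x \<otimes> inv z = x [^] (1::int)"
    using x z comm by (simp add: m_assoc)
  ultimately have "\<not> (4::int) dvd 1 - 1"
    using not_1_mod_4 x z nx by blast
  then show False
    by simp
qed

lemma (in unique_prime_subgroup) normalizing_relations:
  assumes x: "x \<in> carrier G" and y: "y \<in> carrier G" "y \<notin> generate G {x}" "x \<notin> generate G {y}"
    and conj: "y \<otimes> x \<otimes> inv y \<in> generate G {x}" and pow: "y [^] p \<in> generate G {x}"
  shows "p = 2 \<and> (\<exists>e\<ge>2. ord x = 2 ^ e \<and> y [^] (2::nat) = x [^] (2 ^ (e - 1) :: nat) \<and> y \<otimes> x \<otimes> inv y = inv x)"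
proof -
  have x1: "x \<noteq> \<one>"
    using y generate.one by metis
  obtain s :: int where s: "y [^] p = x [^] s"
    using pow x by (auto simp: mem_generate_iff_int_pow)
  obtain r :: int where r: "y \<otimes> x \<otimes> inv y = x [^] r"
    using conj x by (auto simp: mem_generate_iff_int_pow)
  show ?thesis
    using p_eq_2[OF x x1 y r s] noncyclic_relations[OF x x1 y r s] by blast
qed

lemma (in group) generate_singleton_normalI:
  assumes x: "x \<in> carrier G" and "\<And>g. g \<in> carrier G \<Longrightarrow> g \<otimes> x \<otimes> inv g \<in> generate G {x}"
  shows "generate G {x} \<lhd> G"
proof (rule normal_invI)
  show sub: "subgroup (generate G {x}) G"
    using x by (intro generate_is_subgroup) simp
  show "g \<otimes> h \<otimes> inv g \<in> generate G {x}" if h: "h \<in> generate G {x}" and g: "g \<in> carrier G" for h g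
  proof -
    obtain k :: int where "h = x [^] k"
      using h x by (auto simp: mem_generate_iff_int_pow)
    then show ?thesis
      using assms g subgroup_int_pow_closed[OF sub] by (simp add: conj_int_pow)
  qed
qed

text \<open>Were the centralizer of \<open>\<langle>x\<rangle>\<close> larger than \<open>\<langle>x\<rangle>\<close>, the last term of the lower central series
  at which this is visible would provide an element \<open>y\<close> of it that is central modulo \<open>\<langle>x\<rangle>\<close>, and a power
  of \<open>y\<close> would generate a larger normal cyclic subgroup.\<close>

lemma (in unique_prime_subgroup) centralizer_maximal_normal_cyclic:
  assumes nil: "nilpotent_group G"
    and x: "x \<in> carrier G" and normal: "generate G {x} \<lhd> G"
    and max: "\<And>z. z \<in> carrier G \<Longrightarrow> generate G {z} \<lhd> G \<Longrightarrow> generate G {x} \<subseteq> generate G {z} \<Longrightarrow> z \<in> generate G {x}"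
    and y: "y \<in> carrier G" "y \<otimes> x = x \<otimes> y"
  shows "y \<in> generate G {x}"
proof (rule ccontr)
  assume ny: "y \<notin> generate G {x}"
  interpret A: normal "generate G {x}" G
    by (rule normal)
  define S where "S = {y \<in> carrier G. y \<otimes> x = x \<otimes> y \<and> y \<notin> generate G {x}}"
  obtain N where "lower_central G N = {\<one>}"
    using nil by (auto simp: nilpotent_group_def)
  then have N: "lower_central G N \<inter> S = {}"
    using generate.one by (auto simp: S_def)
  have "lower_central G 0 \<inter> S \<noteq> {}"
    using y ny by (auto simp: S_def)
  \<comment> \<open>Term \<open>n\<close> meets \<open>S\<close> but the next one does not, so a
    commutator of \<open>w\<close> that centralizes \<open>x\<close> must lie in
    \<open><x>\<close>.\<close>
  then obtain n where n: "lower_central G n \<inter> S \<noteq> {}" "lower_central G (Suc n) \<inter> S = {}"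
    using N by (induction N) blast+
  then obtain w where w: "w \<in> lower_central G n" "w \<in> carrier G" "w \<otimes> x = x \<otimes> w" "w \<notin> generate G {x}"
    by (auto simp: S_def)
  have comm_pow: "u \<otimes> a = a \<otimes> u" if u: "u \<in> carrier G" "u \<otimes> x = x \<otimes> u" and a: "a \<in> generate G {x}" for u a
  proof -
    have "u \<otimes> x \<otimes> inv u = x [^] (1::int)"
      using u x by (simp add: m_assoc)
    moreover obtain k :: int where "a = x [^] k"
      using a x by (auto simp: mem_generate_iff_int_pow)
    ultimately show ?thesis
      using conj_eq_int_pow_imp_swap[OF u(1) x, of 1 k] by simp
  qed
  have conj_w: "\<exists>a \<in> generate G {x}. g \<otimes> w \<otimes> inv g = a \<otimes> w" if g: "g \<in> carrier G" for g
  proof -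
    \<comment> \<open>\<open>c\<close> is the commutator of \<open>w\<close> and \<open>g\<close>.
      \<open>v\<close> centralizes \<open>x\<close> because \<open>inv w\<close> centralizes the
      conjugate of \<open>x\<close> by \<open>inv g\<close>, an element of the normal subgroup
      \<open><x>\<close>; hence so does \<open>c = w v\<close>.\<close>
    define v where "v = g \<otimes> inv w \<otimes> inv g"
    define c where "c = w \<otimes> v"
    have v: "v \<in> carrier G"
      using g w by (simp add: v_def)
    have "inv g \<otimes> x \<otimes> g \<in> generate G {x}"
      by (rule A.inv_op_closed1[OF g generate.incl]) simp
    then have "w \<otimes> (inv g \<otimes> x \<otimes> g) = (inv g \<otimes> x \<otimes> g) \<otimes> w"
      using w comm_pow by blast
    then have "inv w \<otimes> (inv g \<otimes> x \<otimes> g) = (inv g \<otimes> x \<otimes> g) \<otimes> inv w"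
      using g x w by (intro inv_swap) simp_all
    then have "g \<otimes> (inv w \<otimes> (inv g \<otimes> x \<otimes> g)) \<otimes> inv g = g \<otimes> ((inv g \<otimes> x \<otimes> g) \<otimes> inv w) \<otimes> inv g"
      by simp
    then have vx: "v \<otimes> x = x \<otimes> v"
      using g x w by (simp add: v_def m_assoc)
    have "c \<in> lower_central G (Suc n)"
      using commutator_in_lower_central[OF w(1) g] w(2) g
      by (simp add: c_def v_def m_assoc del: lower_central.simps)
    moreover have "c \<in> carrier G" "c \<otimes> x = x \<otimes> c"
      using v w x vx by (simp_all add: c_def m_assoc) (metis m_assoc)
    ultimately have c: "c \<in> generate G {x}"
      using n(2) by (auto simp: S_def)
    have "g \<otimes> w \<otimes> inv g = inv c \<otimes> w"
      using g w(2) by (simp add: c_def v_def inv_mult_group m_assoc)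
    then show ?thesis
      using c A.m_inv_closed by blast
  qed
  obtain i where i: "w [^] (p ^ i) \<notin> generate G {x}" "w [^] (p ^ Suc i) \<in> generate G {x}"
    using power_leaving_subgroup[OF A.subgroup_axioms w(2,4)] by blast
  \<comment> \<open>\<open>z\<close> commutes with \<open>x\<close> and \<open>z^p\<close> lies in
    \<open><x>\<close>, so \<open>x\<close> lies in \<open><z>\<close>. A conjugate of
    \<open>z\<close> is \<open>(a w)^(p^i) = a^(p^i) z\<close>, so \<open><z>\<close> is a normal
    subgroup strictly larger than \<open><x>\<close>.\<close>
  define z where "z = w [^] (p ^ i)"
  have z: "z \<in> carrier G" "z \<notin> generate G {x}" "z [^] p \<in> generate G {x}"
    using i w(2) by (simp_all add: z_def nat_pow_pow mult.commute)
  have "z \<otimes> x = x \<otimes> z"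
    using w x by (simp add: z_def group_commutes_pow)
  then have xz: "x \<in> generate G {z}"
    by (rule commuting_in_generate[OF x z])
  have sub_z: "subgroup (generate G {z}) G"
    using z by (intro generate_is_subgroup) simp
  have "generate G {x} \<subseteq> generate G {z}"
    using xz sub_z by (intro generate_subgroup_incl) simp_all
  moreover have "generate G {z} \<lhd> G"
  proof (rule generate_singleton_normalI[OF z(1)])
    fix g assume g: "g \<in> carrier G"
    obtain a where a: "a \<in> generate G {x}" "g \<otimes> w \<otimes> inv g = a \<otimes> w"
      using conj_w[OF g] by blast
    then have aG: "a \<in> carrier G"
      by simp
    have "g \<otimes> z \<otimes> inv g = (a \<otimes> w) [^] (p ^ i)"
      using conj_int_pow[OF g w(2), of "int (p ^ i)"] a(2) unfolding int_pow_int z_def by simp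
    also have "\<dots> = a [^] (p ^ i) \<otimes> z"
      using comm_pow[OF w(2,3) a(1)] aG w(2) by (simp add: pow_mult_distrib z_def)
    also have "\<dots> \<in> generate G {z}"
    proof (rule subgroup.m_closed[OF sub_z])
      have "a [^] (p ^ i) \<in> generate G {x}"
        using subgroup_int_pow_closed[OF A.subgroup_axioms a(1), of "int (p ^ i)"] by (simp only: int_pow_int)
      then show "a [^] (p ^ i) \<in> generate G {z}"
        using \<open>generate G {x} \<subseteq> generate G {z}\<close> by blast
      show "z \<in> generate G {z}"
        by (auto intro: generate.incl)
    qed
    finally show "g \<otimes> z \<otimes> inv g \<in> generate G {z}" .
  qed
  ultimately show False
    using max z by blast
qed

text \<open>A maximal normal cyclic subgroup \<open><x>\<close> contains its centralizer, so
  \<open>normalizing_relations\<close> covers each outside element whose \<open>p\<close>-th power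
  is inside. It remains to see that all outside elements are of this kind and fill a single
  coset.\<close>

theorem (in unique_prime_subgroup) cyclic_or_quaternion_relations:
  assumes fin: "finite (carrier G)" and nil: "nilpotent_group G"
  shows "(\<exists>x \<in> carrier G. carrier G = generate G {x}) \<or>
    p = 2 \<and> (\<exists>x \<in> carrier G. \<exists>y \<in> carrier G. \<exists>e\<ge>2. ord x = 2 ^ e \<and> y [^] (2::nat) = x [^] (2 ^ (e - 1) :: nat) \<and>
      y \<otimes> x \<otimes> inv y = inv x \<and> y \<notin> generate G {x} \<and>
      (\<forall>g \<in> carrier G. g \<in> generate G {x} \<or> (\<exists>a \<in> generate G {x}. g = a \<otimes> y)))"
proof -
  define N where "N = {generate G {x} | x. x \<in> carrier G \<and> generate G {x} \<lhd> G}"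
  have "N \<subseteq> Pow (carrier G)"
    using generate_incl[of "{x}" for x] by (auto simp: N_def)
  then have "finite N"
    using fin finite_subset by auto
  moreover have "generate G {\<one>} \<in> N"
    unfolding N_def using one_is_normal by (intro CollectI exI[of _ "\<one>"]) (simp add: generate_one)
  ultimately obtain A where A: "A \<in> N" "\<And>B. B \<in> N \<Longrightarrow> A \<subseteq> B \<Longrightarrow> B = A"
    using finite_has_maximal[of N] by blast
  then obtain x where x: "x \<in> carrier G" "generate G {x} \<lhd> G" and A_def: "A = generate G {x}"
    by (auto simp: N_def)
  have cent: "y \<in> generate G {x}" if "y \<in> carrier G" "y \<otimes> x = x \<otimes> y" for y
  proof (rule centralizer_maximal_normal_cyclic[OF nil x _ that])
    show "z \<in> generate G {x}" if "z \<in> carrier G" "generate G {z} \<lhd> G" "generate G {x} \<subseteq> generate G {z}" for z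
      using A(2)[of "generate G {z}"] that generate.incl[of z "{z}" G] by (auto simp: N_def A_def)
  qed
  interpret A: normal "generate G {x}" G
    by (rule x)
  have comm_mem: "u \<otimes> x = x \<otimes> u" if u: "x \<in> generate G {u}" "u \<in> carrier G" for u
  proof -
    obtain k :: int where "x = u [^] k"
      using u by (auto simp: mem_generate_iff_int_pow)
    then show ?thesis
      using u(2) by (metis int_pow_1 int_pow_mult add.commute)
  qed
  have rel: "p = 2 \<and> (\<exists>e\<ge>2. ord x = 2 ^ e \<and> y [^] (2::nat) = x [^] (2 ^ (e - 1) :: nat) \<and> y \<otimes> x \<otimes> inv y = inv x)"
    if "y \<in> carrier G" "y \<notin> generate G {x}" "y [^] p \<in> generate G {x}" for y
  proof (rule normalizing_relations[OF x(1) that(1,2) _ _ that(3)])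
    \<comment> \<open>If \<open>x\<close> were a power of \<open>y\<close>, then \<open>y\<close>
      would centralize \<open>x\<close> and lie in \<open><x>\<close>.\<close>
    show "x \<notin> generate G {y}"
      using cent comm_mem that by blast
    show "y \<otimes> x \<otimes> inv y \<in> generate G {x}"
      by (rule A.inv_op_closed2[OF that(1) generate.incl]) simp
  qed
  show ?thesis
  proof (cases "carrier G = generate G {x}")
    case True
    then show ?thesis
      using x(1) by blast
  next
    case False
    then obtain y0 where "y0 \<in> carrier G" "y0 \<notin> generate G {x}"
      using A.subset by blast
    then obtain i where "y0 [^] (p ^ i) \<notin> generate G {x}" "y0 [^] (p ^ Suc i) \<in> generate G {x}"
      using power_leaving_subgroup[OF A.subgroup_axioms] by blast
    then obtain y where y: "y \<in> carrier G" "y \<notin> generate G {x}" "y [^] p \<in> generate G {x}"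
      using \<open>y0 \<in> carrier G\<close> by (metis nat_pow_closed nat_pow_pow power_Suc2)
    obtain e where p2: "p = 2" and e: "e \<ge> 2" "ord x = 2 ^ e" "y [^] (2::nat) = x [^] (2 ^ (e - 1) :: nat)"
      "y \<otimes> x \<otimes> inv y = inv x"
      using rel[OF y] by blast
    have "\<exists>a \<in> generate G {x}. g = a \<otimes> y" if g: "g \<in> carrier G" and ng: "g \<notin> generate G {x}" for g
    proof -
      obtain i where i: "g [^] (p ^ i) \<notin> generate G {x}" "g [^] (p ^ Suc i) \<in> generate G {x}"
        using power_leaving_subgroup[OF A.subgroup_axioms g ng] by blast
      have inv: "g [^] (p ^ i) \<otimes> x \<otimes> inv (g [^] (p ^ i)) = inv x"
        using rel[of "g [^] (p ^ i)"] i g by (auto simp: nat_pow_pow mult.commute)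
      \<comment> \<open>For \<open>i > 0\<close> there is \<open>v\<close> with
        \<open>v^2 = g^(p^i)\<close>, which inverts \<open>x\<close>, while \<open>v\<close> sends
        \<open>x\<close> to some \<open>x^t\<close>. Then \<open>t^2\<close> is \<open>-1\<close>
        modulo \<open>ord x\<close>, hence modulo 4, which is impossible.\<close>
      have "i = 0"
      proof (rule ccontr)
        assume "i \<noteq> 0"
        then obtain j where j: "i = Suc j"
          using not0_implies_Suc by blast
        define v where "v = g [^] (p ^ j)"
        have v: "v \<in> carrier G" "v [^] (2::nat) = g [^] (p ^ i)"
          using g by (simp_all add: v_def nat_pow_pow p2 j mult.commute)
        have "v \<otimes> x \<otimes> inv v \<in> generate G {x}"
          by (rule A.inv_op_closed2[OF v(1) generate.incl]) simp
        then obtain t :: int where t: "v \<otimes> x \<otimes> inv v = x [^] t"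
          using x by (auto simp: mem_generate_iff_int_pow)
        have "v [^] (2::nat) \<otimes> x = x [^] (t ^ 2) \<otimes> v [^] (2::nat)"
          by (rule nat_pow_swap[OF v(1) x(1) t])
        then have "x [^] (t ^ 2) = inv x"
          using inv v x(1) by (metis inv_solve_right' int_pow_closed m_closed nat_pow_closed)
        then have "x [^] (t ^ 2) = x [^] (- 1 :: int)"
          using x(1) int_pow_neg[of x 1] by simp
        then have "int (ord x) dvd - 1 - t ^ 2"
          using int_pow_eq[OF x(1)] by blast
        moreover have "(2::nat) ^ 2 dvd ord x"
          unfolding e(2) using e(1) by (rule le_imp_power_dvd)
        then have "4 dvd int (ord x)"
          by (metis int_dvd_int_iff of_nat_numeral power2_eq_square numeral_times_numeral semiring_norm(11,13))
        ultimately have "4 dvd - 1 - t ^ 2"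
          by (rule dvd_trans[rotated])
        then have *: "4 dvd t * t + 1"
          by (metis dvd_minus_iff minus_diff_eq minus_diff_commute power2_eq_square diff_minus_eq_add)
        show False
        proof (cases "even t")
          case True
          then obtain h where "t = 2 * h"
            by (rule evenE)
          then have "t * t + 1 = 4 * (h * h) + 1"
            by simp
          then show False
            using * by presburger
        next
          case False
          then obtain h where "t = 2 * h + 1"
            by (rule oddE)
          then have "t * t + 1 = 4 * (h * h + h) + 2"
            by (simp add: algebra_simps)
          then show False
            using * by presburger
        qed
      qed
      then have gx: "g \<otimes> x \<otimes> inv g = inv x"
        using inv g by simp
      have swap: "u \<otimes> inv x = x \<otimes> u" if "u \<in> carrier G" "u \<otimes> x \<otimes> inv u = inv x" for u
      proof -
        have "u \<otimes> x \<otimes> inv u = x [^] (- 1 :: int)"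
          using that(2) x(1) int_pow_neg[of x 1] by simp
        from conj_eq_int_pow_imp_swap[OF that(1) x(1) this, of "- 1"] show ?thesis
          using x(1) int_pow_neg[of x 1] by simp
      qed
      \<comment> \<open>Both \<open>g\<close> and \<open>y\<close> invert \<open>x\<close>, so
        \<open>g \<otimes> inv y\<close> centralizes \<open>x\<close> and lies in
        \<open><x>\<close>.\<close>
      have "(g \<otimes> inv y) \<otimes> x = g \<otimes> (inv y \<otimes> x)"
        using g x y by (simp add: m_assoc)
      also have "inv y \<otimes> x = inv x \<otimes> inv y"
        using x y swap e(4) by (intro inv_swap) simp_all
      also have "g \<otimes> (inv x \<otimes> inv y) = (g \<otimes> inv x) \<otimes> inv y"
        using g x y by (simp add: m_assoc)
      also have "g \<otimes> inv x = x \<otimes> g"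
        using g gx by (rule swap)
      finally have "(g \<otimes> inv y) \<otimes> x = x \<otimes> (g \<otimes> inv y)"
        using g x y by (simp add: m_assoc)
      then have "g \<otimes> inv y \<in> generate G {x}"
        using cent g y by simp
      moreover have "g = (g \<otimes> inv y) \<otimes> y"
        using g y by (simp add: m_assoc)
      ultimately show "\<exists>a \<in> generate G {x}. g = a \<otimes> y"
        by blast
    qed
    then show ?thesis
      using p2 e y x(1) by blast
  qed
qed

section \<open>Recognizing cyclic and generalized quaternion groups\<close>

lemma (in group) int_pow_mod_ord:
  assumes "x \<in> carrier G"
  shows "x [^] (k mod int (ord x)) = x [^] k"
  unfolding int_pow_eq[OF assms] by (simp add: minus_mod_eq_mult_div)

lemma (in group) cyclic_iso_integer_mod_group:
  assumes fin: "finite (carrier G)" and x: "x \<in> carrier G" "carrier G = generate G {x}"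
  shows "G \<cong> integer_mod_group (order G)"
proof -
  let ?n = "order G"
  have n: "ord x = ?n" "?n > 0"
    using generate_pow_card[OF x(1)] x fin order_gt_0_iff_finite by (simp_all add: order_def)
  have car: "carrier (integer_mod_group ?n) = {0..<int ?n}"
    using n by (simp add: carrier_integer_mod_group)
  have "(\<lambda>i::int. x [^] i) \<in> hom (integer_mod_group ?n) G"
    using x(1) int_pow_mod_ord[OF x(1)] unfolding n(1) by (intro homI) (simp_all add: int_pow_mult)
  moreover have "inj_on (\<lambda>i::int. x [^] i) {0..<int ?n}"
  proof (rule inj_onI)
    fix i j
    assume ij: "i \<in> {0..<int ?n}" "j \<in> {0..<int ?n}" "x [^] i = x [^] j"
    then have "i mod int ?n = j mod int ?n"
      using int_pow_eq[OF x(1), of i j] by (metis n(1) mod_eq_dvd_iff)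
    then show "i = j"
      using ij by simp
  qed
  moreover have "(\<lambda>i::int. x [^] i) ` {0..<int ?n} = carrier G"
  proof
    show "carrier G \<subseteq> (\<lambda>i::int. x [^] i) ` {0..<int ?n}"
    proof
      fix g
      assume "g \<in> carrier G"
      then obtain k :: int where "g = x [^] k"
        using x by (auto simp: mem_generate_iff_int_pow)
      then have "g = x [^] (k mod int ?n)"
        using int_pow_mod_ord[OF x(1)] n(1) by simp
      moreover have "k mod int ?n \<in> {0..<int ?n}"
        using n(2) pos_mod_bound[of "int ?n" k] pos_mod_sign[of "int ?n" k] by simp
      ultimately show "g \<in> (\<lambda>i::int. x [^] i) ` {0..<int ?n}"
        by blast
    qed
  qed (use x(1) in auto)
  ultimately have "(\<lambda>i::int. x [^] i) \<in> iso (integer_mod_group ?n) G"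
    by (simp add: iso_def bij_betw_def car)
  then show ?thesis
    using group.iso_sym[OF group_integer_mod_group] is_isoI by blast
qed

text \<open>The isomorphism reads the normal form \<open>(i, s)\<close> as \<open>x^i\<close> or
  \<open>x^i y\<close>. The parameter is \<open>Suc e\<close> because \<open>x\<close> has order
  \<open>2 ^ e\<close>, half the order of the group.\<close>

lemma (in group) iso_generalized_quaternion:
  assumes x: "x \<in> carrier G" and y: "y \<in> carrier G" "y \<notin> generate G {x}"
    and e: "e \<ge> 1" "ord x = 2 ^ e"
    and rel: "y [^] (2::nat) = x [^] (2 ^ (e - 1) :: nat)" "y \<otimes> x \<otimes> inv y = inv x"
    and cover: "\<And>g. g \<in> carrier G \<Longrightarrow> g \<in> generate G {x} \<or> (\<exists>a \<in> generate G {x}. g = a \<otimes> y)"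
  shows "G \<cong> generalized_quaternion (Suc e)"
proof -
  let ?Q = "generalized_quaternion (Suc e)"
  define f where "f = (\<lambda>(i::int, s). x [^] i \<otimes> (if s then y else \<one>))"
  have car: "carrier ?Q = {0..<2 ^ e} \<times> UNIV"
    by (simp add: generalized_quaternion_def)
  have mult: "(i, s) \<otimes>\<^bsub>?Q\<^esub> (j, t) = ((i + (if s then - j else j) + (if s \<and> t then 2 ^ (e - 1) else 0)) mod 2 ^ e, s \<noteq> t)"
    for i j s t
    by (simp add: generalized_quaternion_def numeral_2_eq_2)
  have pow_mod: "x [^] (k mod 2 ^ e) = x [^] k" for k :: int
    using int_pow_mod_ord[OF x, of k] e by simp
  have "y \<otimes> x \<otimes> inv y = x [^] (- 1 :: int)"
    using rel(2) x int_pow_neg[of x 1] by simp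
  then have swap: "y \<otimes> x [^] j = x [^] (- j) \<otimes> y" for j :: int
    using conj_eq_int_pow_imp_swap[OF y(1) x, of "- 1"] by simp
  have yy: "y \<otimes> y = x [^] ((2::int) ^ (e - 1))"
    using rel(1) int_pow_int[of G x "2 ^ (e - 1)"] y(1) by (simp add: numeral_2_eq_2)
  have "f \<in> hom ?Q G"
  proof (rule homI)
    show "f u \<in> carrier G" for u
      using x y by (cases u) (simp add: f_def)
    show "f (u \<otimes>\<^bsub>?Q\<^esub> v) = f u \<otimes> f v" for u v
    proof -
      obtain i s j t where uv: "u = (i, s)" "v = (j, t)"
        by (metis surj_pair)
      have "f u \<otimes> f v = x [^] i \<otimes> ((if s then y else \<one>) \<otimes> x [^] j) \<otimes> (if t then y else \<one>)"
        using x y by (simp add: f_def uv m_assoc)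
      also have "(if s then y else \<one>) \<otimes> x [^] j = x [^] (if s then - j else j) \<otimes> (if s then y else \<one>)"
        using x by (simp add: swap)
      also have "x [^] i \<otimes> \<dots> \<otimes> (if t then y else \<one>) = x [^] (i + (if s then - j else j)) \<otimes> ((if s then y else \<one>) \<otimes> (if t then y else \<one>))"
        using x y by (simp only: int_pow_mult) (simp add: m_assoc)
      also have "(if s then y else \<one>) \<otimes> (if t then y else \<one>) =
          x [^] ((if s \<and> t then 2 ^ (e - 1) else 0) :: int) \<otimes> (if s \<noteq> t then y else \<one>)"
        using x y by (simp add: yy)
      finally show ?thesis
        unfolding uv mult f_def using x y by (simp add: pow_mod int_pow_mult m_assoc)
    qed
  qed
  moreover have "inj_on f (carrier ?Q)"
  proof (rule inj_onI)
    fix u v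
    assume uv: "u \<in> carrier ?Q" "v \<in> carrier ?Q" and eq: "f u = f v"
    obtain i s j t where ij: "u = (i, s)" "v = (j, t)"
      by (metis surj_pair)
    \<comment> \<open>The cosets \<open><x> y\<close> and \<open><x>\<close> are disjoint, so the
      value of \<open>f\<close> determines the flag.\<close>
    have no: "x [^] m \<otimes> y \<noteq> x [^] n" for m n :: int
    proof
      assume "x [^] m \<otimes> y = x [^] n"
      then have "y = x [^] (- m) \<otimes> x [^] n"
        using x y by (simp add: int_pow_neg flip: \<open>x [^] m \<otimes> y = x [^] n\<close>)
      then have "y = x [^] (- m + n)"
        using x by (simp only: int_pow_mult)
      then show False
        using y x by (auto simp: mem_generate_iff_int_pow)
    qed
    have "s = t"
      using eq no[of i j] no[of j i] x y by (auto simp: ij f_def split: if_splits)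
    moreover have "x [^] i = x [^] j"
      using eq \<open>s = t\<close> x y by (simp add: ij f_def split: if_splits)
    then have "i mod 2 ^ e = j mod 2 ^ e"
      using int_pow_eq[OF x, of i j] e by (simp add: mod_eq_dvd_iff) (metis dvd_diff_commute)
    then have "i = j"
      using uv by (simp add: car ij)
    ultimately show "u = v"
      by (simp add: ij)
  qed
  moreover have "carrier G \<subseteq> f ` carrier ?Q"
  proof
    fix g
    assume "g \<in> carrier G"
    then obtain a s where a: "a \<in> generate G {x}" "g = a \<otimes> (if s then y else \<one>)"
      using cover generate_in_carrier[of "{x}"] x by (metis (full_types) empty_subsetI insert_subset r_one)
    then obtain k :: int where "a = x [^] k"
      using x by (auto simp: mem_generate_iff_int_pow)
    then have "g = f (k mod 2 ^ e, s)"
      using a by (simp add: f_def pow_mod)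
    moreover have "(k mod 2 ^ e, s) \<in> carrier ?Q"
      by (simp add: car)
    ultimately show "g \<in> f ` carrier ?Q"
      by blast
  qed
  ultimately have "f \<in> iso ?Q G"
    by (auto simp: iso_def bij_betw_def hom_def)
  then show ?thesis
    using group.iso_sym[OF group_generalized_quaternion] e is_isoI by (metis One_nat_def Suc_le_mono numeral_2_eq_2)
qed

text \<open>Commutation makes multiplication a homomorphism on the product, trivial intersection
  makes it injective, and counting then makes it surjective.\<close>

lemma (in group) internal_direct_product_iso:
  assumes fin: "finite (carrier G)" and P: "subgroup P G" and Q: "subgroup Q G"
    and Int: "P \<inter> Q = {\<one>}" and card: "card P * card Q = order G"
    and comm: "\<And>u v. u \<in> P \<Longrightarrow> v \<in> Q \<Longrightarrow> u \<otimes> v = v \<otimes> u"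
  shows "G \<cong> G\<lparr>carrier := P\<rparr> \<times>\<times> G\<lparr>carrier := Q\<rparr>"
proof -
  interpret P: subgroup P G
    by (rule P)
  interpret Q: subgroup Q G
    by (rule Q)
  define f where "f = (\<lambda>(u, v). u \<otimes> v)"
  have hom: "f \<in> hom (G\<lparr>carrier := P\<rparr> \<times>\<times> G\<lparr>carrier := Q\<rparr>) G"
  proof (rule homI)
    fix u v
    assume "u \<in> carrier (G\<lparr>carrier := P\<rparr> \<times>\<times> G\<lparr>carrier := Q\<rparr>)" "v \<in> carrier (G\<lparr>carrier := P\<rparr> \<times>\<times> G\<lparr>carrier := Q\<rparr>)"
    then obtain a b c d where uv: "u = (a, b)" "v = (c, d)" "a \<in> P" "b \<in> Q" "c \<in> P" "d \<in> Q"
      by (auto simp: DirProd_def)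
    have "a \<otimes> c \<otimes> (b \<otimes> d) = a \<otimes> (c \<otimes> b) \<otimes> d"
      using uv by (simp add: m_assoc)
    also have "\<dots> = (a \<otimes> b) \<otimes> (c \<otimes> d)"
      using uv by (simp add: comm m_assoc)
    finally show "f (u \<otimes>\<^bsub>G\<lparr>carrier := P\<rparr> \<times>\<times> G\<lparr>carrier := Q\<rparr>\<^esub> v) = f u \<otimes> f v"
      by (simp add: uv f_def)
  qed (auto simp: f_def DirProd_def)
  have inj: "inj_on f (P \<times> Q)"
  proof (rule inj_onI)
    fix u v
    assume "u \<in> P \<times> Q" "v \<in> P \<times> Q" and eq: "f u = f v"
    then obtain a b c d where uv: "u = (a, b)" "v = (c, d)" "a \<in> P" "b \<in> Q" "c \<in> P" "d \<in> Q"
      by auto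
    have "inv c \<otimes> (a \<otimes> b) \<otimes> inv b = inv c \<otimes> (c \<otimes> d) \<otimes> inv b"
      using eq by (simp add: uv f_def)
    then have "inv c \<otimes> a = d \<otimes> inv b"
      using uv by (simp add: m_assoc)
    moreover have "inv c \<otimes> a \<in> P" "d \<otimes> inv b \<in> Q"
      using uv by simp_all
    ultimately have "inv c \<otimes> a = \<one>" "d \<otimes> inv b = \<one>"
      using Int by (metis IntI singletonD)+
    then show "u = v"
      using uv by (metis P.mem_carrier Q.mem_carrier inv_closed inv_equality inv_inv)
  qed
  have "f ` (P \<times> Q) \<subseteq> carrier G"
    by (auto simp: f_def)
  moreover have "card (f ` (P \<times> Q)) = card (carrier G)"
    using card_image[OF inj] card by (simp add: card_cartesian_product order_def)
  ultimately have "f ` (P \<times> Q) = carrier G"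
    using fin by (intro card_subset_eq)
  with hom inj have "f \<in> iso (G\<lparr>carrier := P\<rparr> \<times>\<times> G\<lparr>carrier := Q\<rparr>) G"
    by (simp add: iso_def bij_betw_def DirProd_def)
  then show ?thesis
    using group.iso_sym[OF DirProd_group[OF subgroup_imp_group[OF P] subgroup_imp_group[OF Q]]] is_isoI by blast
qed

section \<open>The classification\<close>

lemma (in group) ord_consistent:
  assumes "subgroup H G"
  shows "group.ord (G\<lparr>carrier := H\<rparr>) x = ord x"
proof -
  interpret H: group "G\<lparr>carrier := H\<rparr>"
    using assms by (rule subgroup_imp_group)
  show ?thesis
    unfolding ord_def H.ord_def by (simp flip: nat_pow_consistent)
qed

lemma (in group) ord_dvd_card_subgroup:
  assumes "subgroup H G" "x \<in> H"
  shows "ord x dvd card H"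
proof -
  interpret H: group "G\<lparr>carrier := H\<rparr>"
    using assms(1) by (rule subgroup_imp_group)
  show ?thesis
    using H.ord_dvd_group_order[of x] assms by (simp add: ord_consistent order_def)
qed

text \<open>Cauchy's theorem, from Sylow existence with exponent 1, where the cofactor
  \<open>m\<close> may still be divisible by \<open>r\<close>.\<close>

lemma (in group) exists_ord_eq_prime:
  assumes "finite (carrier G)" "Factorial_Ring.prime r" "r dvd order G"
  shows "\<exists>x \<in> carrier G. ord x = r"
proof -
  obtain m where "order G = r ^ 1 * m"
    using assms(3) by auto
  then obtain H where H: "subgroup H G" "card H = r ^ 1"
    using sylow_thm[OF assms(2) is_group _ assms(1)] by blast
  have "r > 1"
    using assms(2) prime_gt_1_nat by blast
  then have "H \<noteq> {\<one>}"
    using H(2) by auto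
  then obtain x where x: "x \<in> H" "x \<noteq> \<one>"
    using subgroup.one_closed[OF H(1)] by blast
  then have "x \<in> carrier G"
    using H(1) subgroup.mem_carrier by metis
  moreover have "ord x dvd r" "ord x \<noteq> 1"
    using ord_dvd_card_subgroup[OF H(1) x(1)] H(2) ord_eq_1 \<open>x \<in> carrier G\<close> x(2) by simp_all
  ultimately show ?thesis
    using assms(2) prime_nat_iff by blast
qed

lemma (in unique_prime_subgroup) cyclic_or_quaternion:
  assumes "finite (carrier G)" "nilpotent_group G"
  shows "(\<exists>x \<in> carrier G. carrier G = generate G {x}) \<or> p = 2 \<and> (\<exists>c\<ge>3. G \<cong> generalized_quaternion c)"
  using cyclic_or_quaternion_relations[OF assms]
proof (elim disjE conjE bexE exE)
  fix x y and e :: nat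
  assume "x \<in> carrier G" "y \<in> carrier G" "2 \<le> e" "ord x = 2 ^ e" "y [^] (2::nat) = x [^] (2 ^ (e - 1) :: nat)"
    "y \<otimes> x \<otimes> inv y = inv x" "y \<notin> generate G {x}"
    and "\<forall>g \<in> carrier G. g \<in> generate G {x} \<or> (\<exists>a \<in> generate G {x}. g = a \<otimes> y)"
  then have "G \<cong> generalized_quaternion (Suc e)"
    by (intro iso_generalized_quaternion[of x y e]) simp_all
  moreover have "Suc e \<ge> 3"
    using \<open>2 \<le> e\<close> by simp
  moreover assume "p = 2"
  ultimately show ?thesis
    by blast
qed blast

text \<open>Element orders and cyclic subgroups are the same in \<open>P\<close> as in
  \<open>G\<close>, so uniqueness in \<open>G\<close> is inherited by \<open>P\<close>.\<close>

lemma (in group) p_subgroup_cyclic_or_quaternion: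
  assumes fin: "finite (carrier G)" and nil: "nilpotent_group G"
    and P: "subgroup P G" "card P = p ^ a" and p: "Factorial_Ring.prime p"
    and unique: "\<And>u v. u \<in> carrier G \<Longrightarrow> v \<in> carrier G \<Longrightarrow> ord u = p \<Longrightarrow> ord v = p \<Longrightarrow> v \<in> generate G {u}"
  shows "(\<exists>x \<in> P. P = generate G {x}) \<or> p = 2 \<and> (\<exists>c\<ge>3. G\<lparr>carrier := P\<rparr> \<cong> generalized_quaternion c)"
proof -
  interpret P: subgroup P G
    by (rule P)
  interpret GP: group "G\<lparr>carrier := P\<rparr>"
    using P(1) by (rule subgroup_imp_group)
  have gen: "generate (G\<lparr>carrier := P\<rparr>) {u} = generate G {u}" if "u \<in> P" for u
    using that P(1) by (intro generate_consistent) simp_all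
  interpret U: unique_prime_subgroup "G\<lparr>carrier := P\<rparr>" p
  proof unfold_locales
    show "Factorial_Ring.prime p"
      by (rule p)
    show "\<exists>k. GP.ord x = p ^ k" if "x \<in> carrier (G\<lparr>carrier := P\<rparr>)" for x
      using ord_dvd_card_subgroup[OF P(1), of x] that divides_primepow_nat[OF p] by (auto simp: ord_consistent[OF P(1)] P(2))
    show "v \<in> generate (G\<lparr>carrier := P\<rparr>) {u}"
      if "u \<in> carrier (G\<lparr>carrier := P\<rparr>)" "v \<in> carrier (G\<lparr>carrier := P\<rparr>)" "GP.ord u = p" "GP.ord v = p" for u v
      using that unique[of u v] by (simp add: ord_consistent[OF P(1)] gen)
  qed
  have "finite (carrier (G\<lparr>carrier := P\<rparr>))"
    using fin P.subset finite_subset by auto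
  then have "(\<exists>x \<in> carrier (G\<lparr>carrier := P\<rparr>). carrier (G\<lparr>carrier := P\<rparr>) = generate (G\<lparr>carrier := P\<rparr>) {x}) \<or>
      p = 2 \<and> (\<exists>c\<ge>3. G\<lparr>carrier := P\<rparr> \<cong> generalized_quaternion c)"
    using nilpotent_group_subgroup[OF nil P(1)] by (rule U.cyclic_or_quaternion)
  then show ?thesis
    by (simp add: gen)
qed

text \<open>If \<open>(x y)^n\<close> is trivial, its power with exponent \<open>ord y\<close> shows
  that \<open>ord x\<close> divides \<open>n * ord y\<close>, hence \<open>n\<close>; then
  \<open>y^n\<close> is trivial too. So the order of \<open>x y\<close> is at least that of
  \<open>G\<close>.\<close>

lemma (in group) generate_mult_coprime_cyclic:
  assumes fin: "finite (carrier G)" and x: "x \<in> carrier G" and y: "y \<in> carrier G"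
    and comm: "x \<otimes> y = y \<otimes> x" and "coprime (ord x) (ord y)" and card: "ord x * ord y = order G"
  shows "carrier G = generate G {x \<otimes> y}"
proof -
  define n where "n = ord (x \<otimes> y)"
  have xy: "x [^] n \<otimes> y [^] n = \<one>"
    using pow_ord_eq_1[of "x \<otimes> y"] pow_mult_distrib[OF comm x y, of n] x y by (simp add: n_def)
  have "x [^] (n * ord y) = (x [^] n \<otimes> y [^] n) [^] ord y"
  proof -
    have "x [^] n \<otimes> y [^] n = y [^] n \<otimes> x [^] n"
      using x y comm by (metis group_commutes_pow nat_pow_closed)
    then have "(x [^] n \<otimes> y [^] n) [^] ord y = x [^] (n * ord y) \<otimes> y [^] (n * ord y)"
      using x y by (subst pow_mult_distrib) (simp_all add: nat_pow_pow)
    moreover have "y [^] (n * ord y) = \<one>"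
      using y pow_eq_id by simp
    ultimately show ?thesis
      using x by simp
  qed
  then have "ord x dvd n * ord y"
    using x xy pow_eq_id[OF x] by simp
  then have "ord x dvd n"
    using assms(5) by (simp add: coprime_dvd_mult_left_iff)
  then have "x [^] n = \<one>"
    using pow_eq_id[OF x] by simp
  then have "y [^] n = \<one>"
    using xy y by simp
  then have "ord y dvd n"
    using pow_eq_id[OF y] by simp
  with \<open>ord x dvd n\<close> have "order G dvd n"
    using assms(5) card by (metis divides_mult)
  then have "order G \<le> n"
    using ord_ge_1[OF fin, of "x \<otimes> y"] x y by (intro dvd_imp_le) (simp_all add: n_def)
  then have "card (carrier G) \<le> card (generate G {x \<otimes> y})"
    using generate_pow_card[of "x \<otimes> y"] x y by (simp add: order_def n_def)
  moreover have "generate G {x \<otimes> y} \<subseteq> carrier G"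
    using x y by (intro generate_incl) simp
  ultimately show ?thesis
    using fin by (metis card_seteq)
qed

text \<open>At least two primes divide the order since \<open>G\<close> is not a
  \<open>p\<close>-group. A third prime \<open>r\<close> would let \<open>unique\<close>, with
  \<open>z\<close> of order \<open>q\<close>, put an element of order \<open>r\<close> into a
  subgroup of order \<open>p\<close>.\<close>

lemma (in group) cograph_imp_order_p_q:
  assumes fin: "finite (carrier G)" and nil: "nilpotent_group G" and np: "\<not> (\<exists>p. finite_p_group p G)"
    and unique: "\<And>x y z. \<lbrakk>x \<in> carrier G; y \<in> carrier G; z \<in> carrier G; Factorial_Ring.prime (ord x);
      Factorial_Ring.prime (ord y); Factorial_Ring.prime (ord z); ord z \<noteq> ord x; ord z \<noteq> ord y\<rbrakk> \<Longrightarrow> y \<in> generate G {x}"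
  obtains p q a b where "Factorial_Ring.prime p" "Factorial_Ring.prime q" "p \<noteq> q" "a \<ge> 1" "b \<ge> 1" "order G = p ^ a * q ^ b"
proof -
  have np': "order G \<noteq> r ^ k" if "Factorial_Ring.prime r" for r k
    using np that is_group by (auto simp: finite_p_group_def)
  have pos: "order G > 0"
    using fin order_gt_0_iff_finite by simp
  \<comment> \<open>The trivial group has order \<open>2 ^ 0\<close> and counts as a
    2-group.\<close>
  have "order G \<noteq> 1"
    using np'[of 2 0] by simp
  then obtain p where p: "Factorial_Ring.prime p" "p dvd order G"
    using prime_factor_nat by blast
  obtain a m where a: "order G = p ^ a * m" "\<not> p dvd m"
    using multiplicity_decompose'[of "order G" p] pos p(1) by (metis not_prime_unit bot_nat_0.not_eq_extremum)
  have "m \<noteq> 1"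
    using a np'[OF p(1), of a] by auto
  then obtain q where q: "Factorial_Ring.prime q" "q dvd m"
    using prime_factor_nat by blast
  have "m > 0"
    using a pos by (metis gr0I mult_0_right)
  then obtain b m' where b: "m = q ^ b * m'" "\<not> q dvd m'"
    using multiplicity_decompose'[of m q] q(1) by (metis not_prime_unit bot_nat_0.not_eq_extremum)
  have "p \<noteq> q"
    using a(2) q(2) by blast
  have "a \<ge> 1"
    using a p by (cases a) auto
  have "b \<ge> 1"
    using b q by (cases b) auto
  have "m' = 1"
  proof (rule ccontr)
    assume "m' \<noteq> 1"
    then obtain r where r: "Factorial_Ring.prime r" "r dvd m'"
      using prime_factor_nat by blast
    have "r \<noteq> q" "r \<noteq> p"
      using r(2) b a(2) by (auto intro: dvd_mult)
    have "r dvd order G" "q dvd order G"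
      using r(2) q(2) a(1) b(1) by (auto intro: dvd_mult)
    then obtain x y z where xyz: "x \<in> carrier G" "ord x = p" "y \<in> carrier G" "ord y = r" "z \<in> carrier G" "ord z = q"
      using exists_ord_eq_prime[OF fin] p q(1) r(1) by metis
    then have "y \<in> generate G {x}"
      using unique[of x y z] p q r \<open>p \<noteq> q\<close> \<open>r \<noteq> q\<close> by auto
    then have "r dvd p"
      using ord_dvd_card_subgroup[OF generate_is_subgroup[of "{x}"], of y] xyz generate_pow_card[OF xyz(1)] by simp
    then show False
      using p(1) r(1) \<open>r \<noteq> p\<close> primes_dvd_imp_eq by blast
  qed
  then show thesis
    using that p(1) q(1) \<open>p \<noteq> q\<close> \<open>a \<ge> 1\<close> \<open>b \<ge> 1\<close> a(1) b(1) by simp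
qed

theorem nilpotent_cograph_imp_classification:
  fixes G (structure)
  assumes fin: "finite (carrier G)" and nil: "nilpotent_group G" and np: "\<not> (\<exists>p. finite_p_group p G)"
    and cograph: "cograph (with_proj (intersection_subgroup_graph G))"
  shows "(\<exists>p q a b :: nat. Factorial_Ring.prime p \<and> Factorial_Ring.prime q \<and> p \<noteq> q \<and> a \<ge> 1 \<and> b \<ge> 1 \<and>
        G \<cong> integer_mod_group (p ^ a * q ^ b)) \<or>
     (\<exists>q a b :: nat. Factorial_Ring.prime q \<and> odd q \<and> a \<ge> 3 \<and> b \<ge> 1 \<and>
        G \<cong> generalized_quaternion a \<times>\<times> integer_mod_group (q ^ b))" (is "?cyclic \<or> ?quaternion")
proof -
  interpret group G
    using nil by (simp add: nilpotent_group_def)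
  have unique: "y \<in> generate G {x}"
    if xyz: "x \<in> carrier G" "y \<in> carrier G" "z \<in> carrier G" "Factorial_Ring.prime (ord x)"
      "Factorial_Ring.prime (ord y)" "Factorial_Ring.prime (ord z)" "ord z \<noteq> ord x" "ord z \<noteq> ord y" for x y z
  proof -
    have "u \<otimes> z = z \<otimes> u" if "u \<in> carrier G" "Factorial_Ring.prime (ord u)" "ord z \<noteq> ord u" for u
      using that xyz nilpotent_group_coprime_commute[OF nil that(1) xyz(3) pow_ord_eq_1 pow_ord_eq_1]
      by (simp add: primes_coprime)
    then show ?thesis
      using not_cograph_if_three_prime_orders[of x y z] cograph xyz by blast
  qed
  obtain p q a b where pq: "Factorial_Ring.prime p" "Factorial_Ring.prime q" "p \<noteq> q" "a \<ge> 1" "b \<ge> 1"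
    and order: "order G = p ^ a * q ^ b"
    by (rule cograph_imp_order_p_q[OF fin nil np unique])
  \<comment> \<open>An element whose order is the other prime \<open>r'\<close> serves as the
    \<open>z\<close> of \<open>unique\<close>.\<close>
  have unique_r: "v \<in> generate G {u}"
    if uv: "u \<in> carrier G" "v \<in> carrier G" "ord u = r" "ord v = r" and r: "r = p \<or> r = q" for r u v
  proof -
    define r' where "r' = (if r = p then q else p)"
    have "Factorial_Ring.prime r'" "r' dvd order G" "r' \<noteq> r" "Factorial_Ring.prime r"
      using r pq by (auto simp: r'_def order intro: dvd_mult dvd_mult2)
    then show ?thesis
      using exists_ord_eq_prime[OF fin] unique uv by metis
  qed
  obtain P where P: "subgroup P G" "card P = p ^ a"
    using sylow_thm[OF pq(1) is_group order fin] by blast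
  obtain Q where Q: "subgroup Q G" "card Q = q ^ b"
    using sylow_thm[OF pq(2) is_group _ fin, of b "p ^ a"] order by (metis mult.commute)
  interpret P: subgroup P G
    by (rule P)
  interpret Q: subgroup Q G
    by (rule Q)
  have cop: "coprime (p ^ a) (q ^ b)"
    using pq primes_coprime by simp
  have comm: "u \<otimes> v = v \<otimes> u" if "u \<in> P" "v \<in> Q" for u v
  proof (rule nilpotent_group_coprime_commute[OF nil _ _ _ _ cop])
    show "u [^] (p ^ a) = \<one>" "v [^] (q ^ b) = \<one>"
      using ord_dvd_card_subgroup[OF P(1) that(1)] ord_dvd_card_subgroup[OF Q(1) that(2)] that
      by (simp_all add: pow_eq_id P(2) Q(2))
  qed (use that in simp_all)
  have "ord u = 1" if "u \<in> P \<inter> Q" for u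
    using that ord_dvd_card_subgroup[OF P(1), of u] ord_dvd_card_subgroup[OF Q(1), of u]
      coprime_common_divisor[OF cop, of "ord u"]
    by (simp add: P(2) Q(2))
  then have Int: "P \<inter> Q = {\<one>}"
    using ord_eq_1 by fastforce
  have iso: "G \<cong> G\<lparr>carrier := P\<rparr> \<times>\<times> G\<lparr>carrier := Q\<rparr>"
    using order by (intro internal_direct_product_iso[OF fin P(1) Q(1) Int _ comm]) (simp_all add: P(2) Q(2))
  have cyc: "G\<lparr>carrier := R\<rparr> \<cong> integer_mod_group (card R)" if R: "subgroup R G" "x \<in> R" "R = generate G {x}" for R x
  proof -
    interpret GR: group "G\<lparr>carrier := R\<rparr>"
      using R(1) by (rule subgroup_imp_group)
    have "finite R"
      using fin subgroup.subset[OF R(1)] finite_subset by blast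
    then show ?thesis
      using GR.cyclic_iso_integer_mod_group[of x] generate_consistent[of "{x}" R] R by (simp add: order_def)
  qed
  \<comment> \<open>Stated for arbitrary factors, since either Sylow subgroup may be the quaternion
    one.\<close>
  have quat: ?quaternion
    if "G \<cong> G\<lparr>carrier := R\<rparr> \<times>\<times> G\<lparr>carrier := S\<rparr>" "subgroup R G" "subgroup S G" "c \<ge> 3" "G\<lparr>carrier := R\<rparr> \<cong> generalized_quaternion c"
      "x \<in> S" "S = generate G {x}" "card S = r ^ d" "Factorial_Ring.prime r" "r \<noteq> 2" "d \<ge> 1" for R S c x r d
  proof -
    have "G \<cong> generalized_quaternion c \<times>\<times> integer_mod_group (r ^ d)"
      using iso_trans[OF that(1) group.DirProd_iso_trans[OF subgroup_imp_group[OF that(2)] that(5) cyc[OF that(3,6,7)]]] that(8)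
      by simp
    moreover have "odd r"
      using that(9,10) by (metis prime_odd_nat prime_ge_2_nat le_neq_implies_less)
    ultimately show ?thesis
      using that by blast
  qed
  have structure_P: "(\<exists>x \<in> P. P = generate G {x}) \<or> p = 2 \<and> (\<exists>c\<ge>3. G\<lparr>carrier := P\<rparr> \<cong> generalized_quaternion c)"
    using unique_r by (intro p_subgroup_cyclic_or_quaternion[OF fin nil P pq(1)]) simp
  have structure_Q: "(\<exists>x \<in> Q. Q = generate G {x}) \<or> q = 2 \<and> (\<exists>c\<ge>3. G\<lparr>carrier := Q\<rparr> \<cong> generalized_quaternion c)"
    using unique_r by (intro p_subgroup_cyclic_or_quaternion[OF fin nil Q pq(2)]) simp
  \<comment> \<open>Both factors cannot be generalized quaternion: at most one of the distinct
    primes is 2.\<close>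
  consider x y where "x \<in> P" "P = generate G {x}" "y \<in> Q" "Q = generate G {y}"
    | c y where "p = 2" "c \<ge> 3" "G\<lparr>carrier := P\<rparr> \<cong> generalized_quaternion c" "y \<in> Q" "Q = generate G {y}"
    | c x where "q = 2" "c \<ge> 3" "G\<lparr>carrier := Q\<rparr> \<cong> generalized_quaternion c" "x \<in> P" "P = generate G {x}"
    using structure_P structure_Q pq(3) by blast
  then show ?thesis
  proof cases
    case 1
    then have "ord x = p ^ a" "ord y = q ^ b"
      using generate_pow_card P(2) Q(2) by (metis P.mem_carrier, metis Q.mem_carrier)
    then have "carrier G = generate G {x \<otimes> y}"
      using 1 cop order comm by (intro generate_mult_coprime_cyclic[OF fin]) simp_all
    then have "G \<cong> integer_mod_group (p ^ a * q ^ b)"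
      using cyclic_iso_integer_mod_group[OF fin m_closed[OF P.mem_carrier[OF 1(1)] Q.mem_carrier[OF 1(3)]]]
      by (simp only: order)
    then show ?thesis
      using pq by blast
  next
    case 2
    then show ?thesis
      using quat[OF iso P(1) Q(1) 2(2-5) Q(2) pq(2)] pq by auto
  next
    case 3
    have "G \<cong> G\<lparr>carrier := Q\<rparr> \<times>\<times> G\<lparr>carrier := P\<rparr>"
      using iso DirProd_commute_iso by (rule iso_trans)
    then show ?thesis
      using quat[OF _ Q(1) P(1) 3(2-5) P(2) pq(1)] 3(1) pq by auto
  qed
qed

theorem theorem6p1:
  fixes G :: "('a, 'b) monoid_scheme"
  assumes "group G" and "finite (carrier G)" and "nilpotent_group G"
    and "\<not> (\<exists>p. finite_p_group p G)"
  shows "cograph (with_proj (intersection_subgroup_graph G)) \<longleftrightarrow>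
     (\<exists>p q a b :: nat. Factorial_Ring.prime p \<and> Factorial_Ring.prime q \<and> p \<noteq> q \<and> a \<ge> 1 \<and> b \<ge> 1 \<and>
        G \<cong> integer_mod_group (p ^ a * q ^ b)) \<or>
     (\<exists>q a b :: nat. Factorial_Ring.prime q \<and> odd q \<and> a \<ge> 3 \<and> b \<ge> 1 \<and>
        G \<cong> generalized_quaternion a \<times>\<times> integer_mod_group (q ^ b))"
proof
  assume "cograph (with_proj (intersection_subgroup_graph G))"
  with assms(2-4) show "(\<exists>p q a b :: nat. Factorial_Ring.prime p \<and> Factorial_Ring.prime q \<and> p \<noteq> q \<and> a \<ge> 1 \<and> b \<ge> 1 \<and>
        G \<cong> integer_mod_group (p ^ a * q ^ b)) \<or>
     (\<exists>q a b :: nat. Factorial_Ring.prime q \<and> odd q \<and> a \<ge> 3 \<and> b \<ge> 1 \<and>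
        G \<cong> generalized_quaternion a \<times>\<times> integer_mod_group (q ^ b))"
    by (rule nilpotent_cograph_imp_classification)
next
  interpret group G
    by (rule assms(1))
  assume "(\<exists>p q a b :: nat. Factorial_Ring.prime p \<and> Factorial_Ring.prime q \<and> p \<noteq> q \<and> a \<ge> 1 \<and> b \<ge> 1 \<and>
        G \<cong> integer_mod_group (p ^ a * q ^ b)) \<or>
     (\<exists>q a b :: nat. Factorial_Ring.prime q \<and> odd q \<and> a \<ge> 3 \<and> b \<ge> 1 \<and>
        G \<cong> generalized_quaternion a \<times>\<times> integer_mod_group (q ^ b))"
  \<comment> \<open>Both families have an explicit power pair, and \<open>power_pair_iso\<close>
    carries it back to \<open>G\<close>.\<close>
  then have "\<exists>u v. power_pair G u v"
  proof (elim disjE exE conjE)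
    fix p q a b :: nat
    assume "Factorial_Ring.prime p" "Factorial_Ring.prime q" "a \<ge> 1" "b \<ge> 1"
      and iso: "G \<cong> integer_mod_group (p ^ a * q ^ b)"
    then show ?thesis
      by (intro power_pair_iso[OF assms(1) group_integer_mod_group iso power_pair_integer_mod_group])
  next
    fix q a b :: nat
    assume "Factorial_Ring.prime q" "odd q" "a \<ge> 3" "b \<ge> 1"
      and iso: "G \<cong> generalized_quaternion a \<times>\<times> integer_mod_group (q ^ b)"
    then show ?thesis
      by (intro power_pair_iso[OF assms(1) DirProd_group[OF group_generalized_quaternion group_integer_mod_group]
            iso power_pair_quaternion_times_cyclic]) simp_all
  qed
  then show "cograph (with_proj (intersection_subgroup_graph G))"
    using cograph_if_power_pair by blast
qed

end
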